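(* Let $X$ be a rack and let $A$ be the kernel of $\alpha \times \psi: {\rm As}(X) \to \mathbb{Z}^{\oplus \mathcal{O}_X} \times {\rm Inn}(X)$, where $\alpha: {\rm As}(X) \to \mathbb{Z}^{\oplus \mathcal{O}_X}$ is the abelianization and $\psi: {\rm As}(X) \to {\rm Inn}(X)$ is the canonical epimorphism. Let $\overline{\rm Inn}(X)$ be the image of $\alpha\times\psi$ and $\bar{s}_x = (\alpha \times \psi)(e_x)$ for $x\in X$. Then there exists an isomorphism $$A \cong H_2(\overline{{\rm Inn}}(X)) \;\bigg/ \sum_{x\in X} \langle \bar{s}_x, {\rm Stab}_{\overline{\rm Inn}(X)}(x) \rangle,$$ where $\sum_{x\in X} \langle \bar{s}_x, {\rm Stab}_{\overline{\rm Inn}(X)}(x) \rangle$ is the subgroup of $H_2(\overline{\rm Inn}(X))$ generated by the subgroups $\langle \bar{s}_x, {\rm Stab}_{\overline{\rm Inn}(X)}(x) \rangle$. More precisely, this isomorphism can be chosen so that the central extension $$1 \to A \to {\rm As}(X) \to \overline{\rm Inn}(X) \to 1$$ is equivalent to the extension associated with $\varphi \in {\rm Hom}(H_2(\overline{\rm Inn}(X)), A) \cong H^2(\overline{\rm Inn}(X),A)$, where $A$ is identified with the quotient $H_2(\overline{\rm Inn}(X)) \big/ \sum_{x\in X} \langle \bar{s}_x, {\rm Stab}_{\overline{\rm Inn}(X)}(x) \rangle$ of $H_2(\overline{\rm Inn}(X))$ by the isomorphism and $\varphi: H_2(\overline{\rm Inn}(X)) \to A$ is the projection.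
   Context: A rack is a set $X$ with a binary operation $*$ such that for each $x\in X$ the map $s_x:X\to X$, $s_x(a)=a*x$, is bijective, and $(x*y)*z=(x*z)*(y*z)$ for all $x,y,z$. The inner-automorphism group ${\rm Inn}(X)$ is the group of permutations of $X$ generated by all $s_x$, with multiplication the opposite of composition, so that it acts on $X$ from the right. $\mathcal{O}_X$ is the set of orbits of this action, and $[x]$ is the orbit of $x$. The associated group is ${\rm As}(X)=\langle e_x\ (x\in X)\mid e_xe_y=e_ye_{x*y}\ (x,y\in X)\rangle$. The homomorphism $\psi$ is given by $\psi(e_x)=s_x$. $\mathbb{Z}^{\oplus\mathcal{O}_X}$ is the free abelian group with generators $e_{[x]}$, $[x]\in\mathcal{O}_X$, and $\alpha(e_x)=e_{[x]}$; $\alpha$ induces an isomorphism ${\rm As}(X)_{\rm ab}\cong\mathbb{Z}^{\oplus\mathcal{O}_X}$. The kernel of $\psi$ is central in ${\rm As}(X)$. The group $\overline{\rm Inn}(X)$ acts on $X$ from the right via the projection to ${\rm Inn}(X)$. For a right action of a group $G$ on a set, ${\rm Stab}_G(s)=\{g\in G\mid s\cdot g=s\}$. Each element of ${\rm Stab}_{\overline{\rm Inn}(X)}(x)$ commutes with $\bar s_x$. $H_*(G)=H_*(G,\mathbb{Z})$ is group homology with trivial coefficients. For commuting $g,h$ in a group $G$, the Pontryagin product $\langle g,h\rangle\in H_2(G)$ is $f_*[\mathbb{Z}\times\mathbb{Z}]$, where $f:\mathbb{Z}\times\mathbb{Z}\to G$ sends $(1,0)\mapsto g$, $(0,1)\mapsto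 h$, and $[\mathbb{Z}\times\mathbb{Z}]$ is a fixed generator of $H_2(\mathbb{Z}\times\mathbb{Z})\cong\mathbb{Z}$; it is represented by the inhomogeneous cycle $[g|h]-[h|g]$. If a subgroup $H\subset G$ commutes with $g$, then $\langle g,H\rangle=\{\langle g,h\rangle\mid h\in H\}$, a subgroup of $H_2(G)$. Since $H_1(\overline{\rm Inn}(X))\cong\mathbb{Z}^{\oplus\mathcal{O}_X}$ is free, the universal coefficient theorem (evaluation) gives $H^2(\overline{\rm Inn}(X),A)\cong{\rm Hom}(H_2(\overline{\rm Inn}(X)),A)$ for every abelian group $A$, so central extensions of $\overline{\rm Inn}(X)$ by $A$ are classified up to equivalence by ${\rm Hom}(H_2(\overline{\rm Inn}(X)),A)$. The class of a central extension $1\to A\to E\to G\to1$ is represented by the 2-cocycle $c$ with $\tau(g)\tau(h)=c(g,h)\tau(gh)$ for a set-theoretic section $\tau:G\to E$. *)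

theory Defs
  imports "HOL-Algebra.Free_Abelian_Groups" "HOL-Algebra.Group_Action"
begin

section \<open>Group presentations\<close>

text \<open>A word is a list of letters \<open>(x, b)\<close>, where \<open>(x, True)\<close> stands for the generator \<open>x\<close> and
  \<open>(x, False)\<close> for its formal inverse.  A relation \<open>r = s\<close> is a pair \<open>(r, s)\<close> of words.\<close>

type_synonym 'a word = "('a \<times> bool) list"

definition words :: "'a set \<Rightarrow> 'a word set" where
  "words S = lists (S \<times> UNIV)"

inductive pres_eq :: "'a set \<Rightarrow> ('a word \<times> 'a word) set \<Rightarrow> 'a word \<Rightarrow> 'a word \<Rightarrow> bool"
  for S R where
  refl: "w \<in> words S \<Longrightarrow> pres_eq S R w w"
| sym: "pres_eq S R v w \<Longrightarrow> pres_eq S R w v"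
| trans: "pres_eq S R u v \<Longrightarrow> pres_eq S R v w \<Longrightarrow> pres_eq S R u w"
| cancel: "x \<in> S \<Longrightarrow> u \<in> words S \<Longrightarrow> v \<in> words S \<Longrightarrow>
    pres_eq S R (u @ [(x, b), (x, \<not> b)] @ v) (u @ v)"
| relation: "(r, s) \<in> R \<Longrightarrow> r \<in> words S \<Longrightarrow> s \<in> words S \<Longrightarrow> u \<in> words S \<Longrightarrow> v \<in> words S \<Longrightarrow>
    pres_eq S R (u @ r @ v) (u @ s @ v)"

definition pres_class :: "'a set \<Rightarrow> ('a word \<times> 'a word) set \<Rightarrow> 'a word \<Rightarrow> 'a word set" where
  "pres_class S R w = {v. pres_eq S R w v}"

definition presented_group :: "'a set \<Rightarrow> ('a word \<times> 'a word) set \<Rightarrow> 'a word set monoid" where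
  "presented_group S R =
    \<lparr>carrier = pres_class S R ` words S,
     monoid.mult = (\<lambda>U V. \<Union>u\<in>U. \<Union>v\<in>V. pres_class S R (u @ v)),
     one = pres_class S R []\<rparr>"

definition eval_word :: "('b, 'c) monoid_scheme \<Rightarrow> ('a \<Rightarrow> 'b) \<Rightarrow> 'a word \<Rightarrow> 'b" where
  "eval_word H f w =
    foldr (\<lambda>(x, b) h. (if b then f x else inv\<^bsub>H\<^esub> f x) \<otimes>\<^bsub>H\<^esub> h) w \<one>\<^bsub>H\<^esub>"

text \<open>The homomorphism out of a presented group with prescribed values \<open>f\<close> on the generators.
  It is meaningful only if these values satisfy the relations in \<open>H\<close>.\<close>

definition pres_lift :: "('b, 'c) monoid_scheme \<Rightarrow> ('a \<Rightarrow> 'b) \<Rightarrow> 'a word set \<Rightarrow> 'b" where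
  "pres_lift H f U = the_elem (eval_word H f ` U)"


section \<open>Group homology with integer coefficients\<close>

text \<open>The inhomogeneous bar complex with trivial coefficients: the list \<open>[g\<^sub>1, \<dots>, g\<^sub>n]\<close> is the
  basis element usually written \<open>[g\<^sub>1| \<dots> |g\<^sub>n]\<close>.\<close>

definition bar_basis :: "nat \<Rightarrow> ('g, 'c) monoid_scheme \<Rightarrow> 'g list set" where
  "bar_basis n G = {gs. length gs = n \<and> set gs \<subseteq> carrier G}"

definition bar_chain_group :: "nat \<Rightarrow> ('g, 'c) monoid_scheme \<Rightarrow> ('g list \<Rightarrow>\<^sub>0 int) monoid" where
  "bar_chain_group n G = free_Abelian_group (bar_basis n G)"

definition bar_boundary_basis :: "('g, 'c) monoid_scheme \<Rightarrow> 'g list \<Rightarrow> ('g list \<Rightarrow>\<^sub>0 int)" where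
  "bar_boundary_basis G gs =
    (if gs = [] then 0
     else frag_of (tl gs)
       + (\<Sum>i=1..<length gs. frag_cmul ((-1) ^ i)
            (frag_of (take (i - 1) gs @ [gs ! (i - 1) \<otimes>\<^bsub>G\<^esub> gs ! i] @ drop (i + 1) gs)))
       + frag_cmul ((-1) ^ length gs) (frag_of (butlast gs)))"

definition bar_boundary ::
    "('g, 'c) monoid_scheme \<Rightarrow> ('g list \<Rightarrow>\<^sub>0 int) \<Rightarrow> ('g list \<Rightarrow>\<^sub>0 int)" where
  "bar_boundary G = frag_extend (bar_boundary_basis G)"

definition cycle_group :: "nat \<Rightarrow> ('g, 'c) monoid_scheme \<Rightarrow> ('g list \<Rightarrow>\<^sub>0 int) monoid" where
  "cycle_group n G =
    (bar_chain_group n G)\<lparr>carrier := {z \<in> carrier (bar_chain_group n G). bar_boundary G z = 0}\<rparr>"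

definition boundaries :: "nat \<Rightarrow> ('g, 'c) monoid_scheme \<Rightarrow> ('g list \<Rightarrow>\<^sub>0 int) set" where
  "boundaries n G = bar_boundary G ` carrier (bar_chain_group (Suc n) G)"

definition homology :: "nat \<Rightarrow> ('g, 'c) monoid_scheme \<Rightarrow> ('g list \<Rightarrow>\<^sub>0 int) set monoid" where
  "homology n G = cycle_group n G Mod boundaries n G"

definition homology_class ::
    "nat \<Rightarrow> ('g, 'c) monoid_scheme \<Rightarrow> ('g list \<Rightarrow>\<^sub>0 int) \<Rightarrow> ('g list \<Rightarrow>\<^sub>0 int) set" where
  "homology_class n G z = boundaries n G #>\<^bsub>cycle_group n G\<^esub> z"

definition homology_map :: "nat \<Rightarrow> ('h, 'd) monoid_scheme \<Rightarrow> ('g \<Rightarrow> 'h) \<Rightarrow>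
    ('g list \<Rightarrow>\<^sub>0 int) set \<Rightarrow> ('h list \<Rightarrow>\<^sub>0 int) set" where
  "homology_map n H f U =
    the_elem ((\<lambda>z. homology_class n H (frag_extend (\<lambda>gs. frag_of (map f gs)) z)) ` U)"


section \<open>Pontryagin products\<close>

text \<open>The standard generator of the infinite cyclic group \<open>H\<^sub>2(\<int> \<times> \<int>)\<close>.\<close>

definition torus_class :: "((int \<times> int) list \<Rightarrow>\<^sub>0 int) set" where
  "torus_class = homology_class 2 (integer_group \<times>\<times> integer_group)
    (frag_of [(1, 0), (0, 1)] - frag_of [(0, 1), (1, 0)])"

definition pontryagin ::
    "('g, 'c) monoid_scheme \<Rightarrow> 'g \<Rightarrow> 'g \<Rightarrow> ('g list \<Rightarrow>\<^sub>0 int) set" where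
  "pontryagin G g h =
    homology_map 2 G (\<lambda>(m :: int, n :: int). g [^]\<^bsub>G\<^esub> m \<otimes>\<^bsub>G\<^esub> h [^]\<^bsub>G\<^esub> n) torus_class"

definition pontryagin_set ::
    "('g, 'c) monoid_scheme \<Rightarrow> 'g \<Rightarrow> 'g set \<Rightarrow> ('g list \<Rightarrow>\<^sub>0 int) set set" where
  "pontryagin_set G g H = {pontryagin G g h | h. h \<in> H}"


section \<open>Central extensions and 2-cocycles\<close>

definition central_extension :: "('a, 'x) monoid_scheme \<Rightarrow> ('e, 'y) monoid_scheme \<Rightarrow>
    ('g, 'z) monoid_scheme \<Rightarrow> ('a \<Rightarrow> 'e) \<Rightarrow> ('e \<Rightarrow> 'g) \<Rightarrow> bool" where
  "central_extension A E G i p \<longleftrightarrow>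
    comm_group A \<and> group E \<and> group G \<and>
    i \<in> hom A E \<and> inj_on i (carrier A) \<and>
    p \<in> hom E G \<and> p ` carrier E = carrier G \<and>
    i ` carrier A = kernel E G p \<and>
    (\<forall>a \<in> carrier A. \<forall>e \<in> carrier E. i a \<otimes>\<^bsub>E\<^esub> e = e \<otimes>\<^bsub>E\<^esub> i a)"

definition equivalent_extensions :: "('a, 'x) monoid_scheme \<Rightarrow>
    ('e, 'y) monoid_scheme \<Rightarrow> ('a \<Rightarrow> 'e) \<Rightarrow> ('e \<Rightarrow> 'g) \<Rightarrow>
    ('f, 'z) monoid_scheme \<Rightarrow> ('a \<Rightarrow> 'f) \<Rightarrow> ('f \<Rightarrow> 'g) \<Rightarrow> bool" where
  "equivalent_extensions A E i p F j q \<longleftrightarrow>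
    (\<exists>\<Theta> \<in> iso E F. (\<forall>a \<in> carrier A. \<Theta> (i a) = j a) \<and> (\<forall>e \<in> carrier E. q (\<Theta> e) = p e))"

text \<open>Cocycles need not be normalized.\<close>

definition two_cocycle ::
    "('g, 'c) monoid_scheme \<Rightarrow> ('a, 'd) monoid_scheme \<Rightarrow> ('g \<Rightarrow> 'g \<Rightarrow> 'a) \<Rightarrow> bool" where
  "two_cocycle G A c \<longleftrightarrow>
    (\<forall>g \<in> carrier G. \<forall>h \<in> carrier G. c g h \<in> carrier A) \<and>
    (\<forall>g \<in> carrier G. \<forall>h \<in> carrier G. \<forall>k \<in> carrier G.
      c g h \<otimes>\<^bsub>A\<^esub> c (g \<otimes>\<^bsub>G\<^esub> h) k = c h k \<otimes>\<^bsub>A\<^esub> c g (h \<otimes>\<^bsub>G\<^esub> k))"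

text \<open>The central extension with class \<open>[c]\<close>: the section \<open>\<tau> g = (\<one>, g)\<close> satisfies
  \<open>\<tau> g \<tau> h = c(g, h) \<tau>(g h)\<close>.  The factor \<open>c(1, 1)\<^sup>-\<^sup>1\<close> accounts for cocycles that are not
  normalized.\<close>

definition cocycle_extension :: "('g, 'c) monoid_scheme \<Rightarrow> ('a, 'd) monoid_scheme \<Rightarrow>
    ('g \<Rightarrow> 'g \<Rightarrow> 'a) \<Rightarrow> ('a \<times> 'g) monoid" where
  "cocycle_extension G A c =
    \<lparr>carrier = carrier A \<times> carrier G,
     monoid.mult = (\<lambda>(a, g) (b, h). (a \<otimes>\<^bsub>A\<^esub> b \<otimes>\<^bsub>A\<^esub> c g h, g \<otimes>\<^bsub>G\<^esub> h)),
     one = (inv\<^bsub>A\<^esub> (c \<one>\<^bsub>G\<^esub> \<one>\<^bsub>G\<^esub>), \<one>\<^bsub>G\<^esub>)\<rparr>"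

definition cocycle_incl :: "('g, 'c) monoid_scheme \<Rightarrow> ('a, 'd) monoid_scheme \<Rightarrow>
    ('g \<Rightarrow> 'g \<Rightarrow> 'a) \<Rightarrow> 'a \<Rightarrow> 'a \<times> 'g" where
  "cocycle_incl G A c a = (a \<otimes>\<^bsub>A\<^esub> inv\<^bsub>A\<^esub> (c \<one>\<^bsub>G\<^esub> \<one>\<^bsub>G\<^esub>), \<one>\<^bsub>G\<^esub>)"

text \<open>The evaluation map \<open>H\<^sup>2(G, A) \<rightarrow> Hom(H\<^sub>2(G), A)\<close> of the universal coefficient theorem, on
  the level of cocycles: a chain \<open>\<Sum> n\<^sub>j [g\<^sub>j|h\<^sub>j]\<close> goes to the product of the \<open>c(g\<^sub>j, h\<^sub>j)\<close> to the
  power \<open>n\<^sub>j\<close>.\<close>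

definition eval_on_chain ::
    "('a, 'd) monoid_scheme \<Rightarrow> ('g \<Rightarrow> 'g \<Rightarrow> 'a) \<Rightarrow> ('g list \<Rightarrow>\<^sub>0 int) \<Rightarrow> 'a" where
  "eval_on_chain A c z =
    finprod A (\<lambda>gs. c (gs ! 0) (gs ! 1) [^]\<^bsub>A\<^esub> Poly_Mapping.lookup z gs) (Poly_Mapping.keys z)"

definition eval_cocycle ::
    "('a, 'd) monoid_scheme \<Rightarrow> ('g \<Rightarrow> 'g \<Rightarrow> 'a) \<Rightarrow> ('g list \<Rightarrow>\<^sub>0 int) set \<Rightarrow> 'a" where
  "eval_cocycle A c U = the_elem (eval_on_chain A c ` U)"

text \<open>\<open>represents G A \<phi> c\<close>: the class of \<open>c\<close> corresponds to \<open>\<phi>\<close> under the evaluation map.\<close>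

definition represents :: "('g, 'c) monoid_scheme \<Rightarrow> ('a, 'd) monoid_scheme \<Rightarrow>
    (('g list \<Rightarrow>\<^sub>0 int) set \<Rightarrow> 'a) \<Rightarrow> ('g \<Rightarrow> 'g \<Rightarrow> 'a) \<Rightarrow> bool" where
  "represents G A \<phi> c \<longleftrightarrow>
    two_cocycle G A c \<and> (\<forall>U \<in> carrier (homology 2 G). eval_cocycle A c U = \<phi> U)"


section \<open>Racks\<close>

locale rack =
  fixes X :: "'a set" and rop :: "'a \<Rightarrow> 'a \<Rightarrow> 'a" (infixl "\<triangleright>" 70)
  assumes bij: "x \<in> X \<Longrightarrow> bij_betw (\<lambda>a. a \<triangleright> x) X X"
    and self_distrib: "x \<in> X \<Longrightarrow> y \<in> X \<Longrightarrow> z \<in> X \<Longrightarrow>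
      (x \<triangleright> y) \<triangleright> z = (x \<triangleright> z) \<triangleright> (y \<triangleright> z)"

definition rack_symmetry :: "'a set \<Rightarrow> ('a \<Rightarrow> 'a \<Rightarrow> 'a) \<Rightarrow> 'a \<Rightarrow> ('a \<Rightarrow> 'a)" where
  "rack_symmetry X rop x = (\<lambda>a \<in> X. rop a x)"

definition opposite_group :: "('g, 'c) monoid_scheme \<Rightarrow> ('g, 'c) monoid_scheme" where
  "opposite_group G = G\<lparr>monoid.mult := (\<lambda>g h. h \<otimes>\<^bsub>G\<^esub> g)\<rparr>"

definition Inn :: "'a set \<Rightarrow> ('a \<Rightarrow> 'a \<Rightarrow> 'a) \<Rightarrow> ('a \<Rightarrow> 'a) monoid" where
  "Inn X rop = subgroup_generated (opposite_group (BijGroup X)) (rack_symmetry X rop ` X)"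

text \<open>The constants \<open>orbit\<close>, \<open>orbits\<close> and \<open>stabilizer\<close> of the library are used with right actions:
  the second argument sends a group element \<open>g\<close> to the map \<open>x \<mapsto> x \<cdot> g\<close>.\<close>

definition rack_orbit :: "'a set \<Rightarrow> ('a \<Rightarrow> 'a \<Rightarrow> 'a) \<Rightarrow> 'a \<Rightarrow> 'a set" where
  "rack_orbit X rop x = orbit (Inn X rop) (\<lambda>f. f) x"

definition rack_orbits :: "'a set \<Rightarrow> ('a \<Rightarrow> 'a \<Rightarrow> 'a) \<Rightarrow> 'a set set" where
  "rack_orbits X rop = orbits (Inn X rop) X (\<lambda>f. f)"

definition As_relations :: "'a set \<Rightarrow> ('a \<Rightarrow> 'a \<Rightarrow> 'a) \<Rightarrow> ('a word \<times> 'a word) set" where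
  "As_relations X rop =
    {([(x, True), (y, True)], [(y, True), (rop x y, True)]) | x y. x \<in> X \<and> y \<in> X}"

definition As :: "'a set \<Rightarrow> ('a \<Rightarrow> 'a \<Rightarrow> 'a) \<Rightarrow> 'a word set monoid" where
  "As X rop = presented_group X (As_relations X rop)"

definition As_gen :: "'a set \<Rightarrow> ('a \<Rightarrow> 'a \<Rightarrow> 'a) \<Rightarrow> 'a \<Rightarrow> 'a word set" where
  "As_gen X rop x = pres_class X (As_relations X rop) [(x, True)]"

definition As_alpha :: "'a set \<Rightarrow> ('a \<Rightarrow> 'a \<Rightarrow> 'a) \<Rightarrow> 'a word set \<Rightarrow> ('a set \<Rightarrow>\<^sub>0 int)" where
  "As_alpha X rop =
    pres_lift (free_Abelian_group (rack_orbits X rop)) (\<lambda>x. frag_of (rack_orbit X rop x))"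

definition As_psi :: "'a set \<Rightarrow> ('a \<Rightarrow> 'a \<Rightarrow> 'a) \<Rightarrow> 'a word set \<Rightarrow> ('a \<Rightarrow> 'a)" where
  "As_psi X rop = pres_lift (Inn X rop) (rack_symmetry X rop)"

definition alpha_psi ::
    "'a set \<Rightarrow> ('a \<Rightarrow> 'a \<Rightarrow> 'a) \<Rightarrow> 'a word set \<Rightarrow> ('a set \<Rightarrow>\<^sub>0 int) \<times> ('a \<Rightarrow> 'a)" where
  "alpha_psi X rop u = (As_alpha X rop u, As_psi X rop u)"

definition alpha_psi_target ::
    "'a set \<Rightarrow> ('a \<Rightarrow> 'a \<Rightarrow> 'a) \<Rightarrow> (('a set \<Rightarrow>\<^sub>0 int) \<times> ('a \<Rightarrow> 'a)) monoid" where
  "alpha_psi_target X rop = free_Abelian_group (rack_orbits X rop) \<times>\<times> Inn X rop"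

definition As_kernel :: "'a set \<Rightarrow> ('a \<Rightarrow> 'a \<Rightarrow> 'a) \<Rightarrow> 'a word set monoid" where
  "As_kernel X rop =
    (As X rop)\<lparr>carrier := kernel (As X rop) (alpha_psi_target X rop) (alpha_psi X rop)\<rparr>"

definition Inn_bar ::
    "'a set \<Rightarrow> ('a \<Rightarrow> 'a \<Rightarrow> 'a) \<Rightarrow> (('a set \<Rightarrow>\<^sub>0 int) \<times> ('a \<Rightarrow> 'a)) monoid" where
  "Inn_bar X rop = (alpha_psi_target X rop)\<lparr>carrier := alpha_psi X rop ` carrier (As X rop)\<rparr>"

definition s_bar ::
    "'a set \<Rightarrow> ('a \<Rightarrow> 'a \<Rightarrow> 'a) \<Rightarrow> 'a \<Rightarrow> ('a set \<Rightarrow>\<^sub>0 int) \<times> ('a \<Rightarrow> 'a)" where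
  "s_bar X rop x = alpha_psi X rop (As_gen X rop x)"

definition pontryagin_sum :: "'a set \<Rightarrow> ('a \<Rightarrow> 'a \<Rightarrow> 'a) \<Rightarrow>
    ((('a set \<Rightarrow>\<^sub>0 int) \<times> ('a \<Rightarrow> 'a)) list \<Rightarrow>\<^sub>0 int) set set" where
  "pontryagin_sum X rop =
    generate (homology 2 (Inn_bar X rop))
      (\<Union>x\<in>X. pontryagin_set (Inn_bar X rop) (s_bar X rop x) (stabilizer (Inn_bar X rop) snd x))"

end

theory Submission
  imports Defs
begin


text \<open>
  Write \<open>E = As(X)\<close>, let \<open>G\<close> be the image of \<open>p = \<alpha> \<times> \<psi>\<close>, and let \<open>A\<close> be the kernel of \<open>p\<close>.  In \<open>E\<close>
  one has \<open>e\<^sub>x u = u e\<^sub>y\<close> with \<open>y = x \<cdot> \<psi>(u)\<close> (\<open>conjugate_generator\<close>), so \<open>A\<close> is central.  A set-theoretic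
  section of \<open>p\<close> gives a cocycle \<open>f : G \<times> G \<rightarrow> A\<close>, and evaluating \<open>f\<close> on bar cycles gives a homomorphism
  \<open>\<phi> : H\<^sub>2(G) \<rightarrow> A\<close>.  The theorem says that \<open>\<phi>\<close> is onto, that its kernel is the sum of the subgroups
  \<open>\<langle>p(e\<^sub>x), Stab(x)\<rangle>\<close>, and that \<open>\<phi>\<close> determines the extension.

  For the last point two cocycles that agree on all cycles have to be cohomologous.  The general
  reason is that \<open>H\<^sub>1(G)\<close> is free.  Here the freeness is used through an explicit homomorphism from \<open>G\<close>
  to the 1-chains that sends \<open>g\<close> to a chain homologous to \<open>[g]\<close>: it depends only on the component of
  \<open>g\<close> in the free abelian group on the orbits, and takes the basis element of an orbit to \<open>[p(e\<^sub>r)]\<close>, where \<open>r\<close> is a chosen element of that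
  orbit (\<open>splits_first_homology_Inn_bar\<close>, \<open>agreeing_on_cycles_imp_cohomologous\<close>).

  Surjectivity is the exactness of \<open>H\<^sub>2(G) \<rightarrow> A \<rightarrow> H\<^sub>1(E)\<close>.  Since \<open>\<alpha>\<close> is the abelianization of \<open>E\<close> and
  kills \<open>A\<close>, the group \<open>A\<close> lies in the derived subgroup of \<open>E\<close>.  Modulo the image of \<open>\<phi>\<close> the cocycle \<open>f\<close>
  vanishes on cycles, hence is a coboundary, so the projection of \<open>A\<close> to \<open>A / im \<phi>\<close> extends to \<open>E\<close>; as
  it kills commutators it is trivial (\<open>eval_cocycle_surj\<close>).

  The classes \<open>\<langle>p(e\<^sub>x), h\<rangle>\<close> lie in the kernel because \<open>\<phi>\<close> sends them to the commutator of lifts of \<open>p(e\<^sub>x)\<close> and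
  \<open>h\<close> to \<open>E\<close>, and every lift of an element of \<open>Stab(x)\<close> commutes with \<open>e\<^sub>x\<close>.  Conversely, let \<open>M\<close> be the
  group of 2-chains modulo the boundaries and the cycles representing the classes \<open>\<langle>p(e\<^sub>x), h\<rangle>\<close>.  The
  cocycle \<open>(g, h) \<mapsto> [g|h]\<close> defines a central extension of \<open>G\<close> by \<open>M\<close> in which lifts of \<open>p(e\<^sub>x)\<close> commute with
  lifts of \<open>Stab(x)\<close>.  One can therefore lift one \<open>p(e\<^sub>r)\<close> for each orbit arbitrarily, spread the lifts over the orbits by
  conjugation, and obtain a homomorphism from \<open>E\<close> to that extension over \<open>G\<close>
  (\<open>As_lifts_to_extension\<close>).  By naturality the class of a cycle \<open>z\<close> in \<open>M\<close> is a function of its value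
  under \<open>\<phi>\<close>, so \<open>\<phi>\<close> kills nothing else (\<open>kernel_subset_pontryagin_sum\<close>).
\<close>

section \<open>Presented groups\<close>

lemma Nil_in_words [simp]: "[] \<in> words S"
  by (simp add: words_def)

lemma append_in_words [simp]: "u @ v \<in> words S \<longleftrightarrow> u \<in> words S \<and> v \<in> words S"
  by (auto simp: words_def)

lemma Cons_in_words [simp]: "(x, b) # w \<in> words S \<longleftrightarrow> x \<in> S \<and> w \<in> words S"
  by (auto simp: words_def)

lemma pres_eq_in_words:
  assumes "pres_eq S R v w"
  shows "v \<in> words S" and "w \<in> words S"
  using assms by (induction) auto

lemma pres_eq_append_left:
  assumes "pres_eq S R u v" and "w \<in> words S"
  shows "pres_eq S R (w @ u) (w @ v)"
  using assms
proof induction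
  case (cancel x u v b)
  then show ?case using pres_eq.cancel[of x S "w @ u" v R b] by simp
next
  case (relation r s u v)
  then show ?case using pres_eq.relation[of r s R S "w @ u" v] by simp
qed (auto intro: pres_eq.refl pres_eq.sym pres_eq.trans)

lemma pres_eq_append_right:
  assumes "pres_eq S R u v" and "w \<in> words S"
  shows "pres_eq S R (u @ w) (v @ w)"
  using assms
proof induction
  case (cancel x u v b)
  then show ?case using pres_eq.cancel[of x S u "v @ w" R b] by simp
next
  case (relation r s u v)
  then show ?case using pres_eq.relation[of r s R S u "v @ w"] by simp
qed (auto intro: pres_eq.refl pres_eq.sym pres_eq.trans)

lemma pres_eq_append:
  assumes "pres_eq S R u u'" and "pres_eq S R v v'"
  shows "pres_eq S R (u @ v) (u' @ v')"
  by (meson assms pres_eq.trans pres_eq_append_left pres_eq_append_right pres_eq_in_words)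

lemma pres_class_eq_iff:
  assumes "v \<in> words S"
  shows "pres_class S R v = pres_class S R w \<longleftrightarrow> pres_eq S R v w"
  unfolding pres_class_def set_eq_iff mem_Collect_eq
  by (meson assms pres_eq.refl pres_eq.sym pres_eq.trans)

lemma carrier_presented_group: "carrier (presented_group S R) = pres_class S R ` words S"
  by (simp add: presented_group_def)

lemma one_presented_group: "\<one>\<^bsub>presented_group S R\<^esub> = pres_class S R []"
  by (simp add: presented_group_def)

lemma mult_pres_class:
  assumes "u \<in> words S" and "v \<in> words S"
  shows "pres_class S R u \<otimes>\<^bsub>presented_group S R\<^esub> pres_class S R v = pres_class S R (u @ v)"
proof -
  have "pres_class S R (u' @ v') = pres_class S R (u @ v)"
    if "u' \<in> pres_class S R u" "v' \<in> pres_class S R v" for u' v'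
  proof -
    have "pres_eq S R (u @ v) (u' @ v')"
      using that by (auto simp: pres_class_def intro: pres_eq_append)
    then show ?thesis using assms by (simp add: pres_class_eq_iff[symmetric])
  qed
  moreover have "u \<in> pres_class S R u" "v \<in> pres_class S R v"
    using assms by (auto simp: pres_class_def intro: pres_eq.refl)
  ultimately have "(\<Union>u'\<in>pres_class S R u. \<Union>v'\<in>pres_class S R v. pres_class S R (u' @ v')) =
      pres_class S R (u @ v)"
    by blast
  then show ?thesis
    by (simp add: presented_group_def)
qed

definition inverse_word :: "'a word \<Rightarrow> 'a word" where
  "inverse_word w = rev (map (\<lambda>(x, b). (x, \<not> b)) w)"

lemma inverse_word_in_words: "w \<in> words S \<Longrightarrow> inverse_word w \<in> words S"
  by (induction w) (auto simp: inverse_word_def)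

lemma pres_eq_inverse_word:
  "w \<in> words S \<Longrightarrow> pres_eq S R (inverse_word w @ w) []"
proof (induction w)
  case Nil
  then show ?case by (simp add: inverse_word_def pres_eq.refl)
next
  case (Cons a w)
  obtain x b where a: "a = (x, b)" by fastforce
  with Cons.prems have x: "x \<in> S" and w: "w \<in> words S" by auto
  have "pres_eq S R (inverse_word w @ [(x, \<not> b), (x, \<not> \<not> b)] @ w) (inverse_word w @ w)"
    by (intro pres_eq.cancel x w inverse_word_in_words)
  then show ?case
    using Cons.IH[OF w] by (auto simp: a inverse_word_def intro: pres_eq.trans)
qed

lemma group_presented_group: "group (presented_group S R)"
proof (rule groupI)
  fix U assume "U \<in> carrier (presented_group S R)"
  then obtain u where u: "u \<in> words S" "U = pres_class S R u"
    by (auto simp: carrier_presented_group)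
  have "pres_class S R (inverse_word u) \<otimes>\<^bsub>presented_group S R\<^esub> U = \<one>\<^bsub>presented_group S R\<^esub>"
    using u by (simp add: mult_pres_class inverse_word_in_words one_presented_group
        pres_class_eq_iff pres_eq_inverse_word)
  then show "\<exists>V\<in>carrier (presented_group S R). V \<otimes>\<^bsub>presented_group S R\<^esub> U = \<one>\<^bsub>presented_group S R\<^esub>"
    using u by (auto simp: carrier_presented_group intro!: bexI[of _ "inverse_word u"] inverse_word_in_words)
qed (auto simp: carrier_presented_group one_presented_group mult_pres_class)

lemma carrier_presented_group_generate:
  "carrier (presented_group S R) =
    generate (presented_group S R) ((\<lambda>x. pres_class S R [(x, True)]) ` S)"
  (is "carrier ?G = generate ?G ?gens")
proof
  interpret group ?G by (rule group_presented_group)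
  have gens: "?gens \<subseteq> carrier ?G"
    by (auto simp: carrier_presented_group)
  show "generate ?G ?gens \<subseteq> carrier ?G"
    by (rule generate_incl[OF gens])
  have "pres_class S R w \<in> generate ?G ?gens" if "w \<in> words S" for w
    using that
  proof (induction w)
    case Nil
    then show ?case using generate.one by (metis one_presented_group)
  next
    case (Cons a w)
    obtain x b where a: "a = (x, b)" by fastforce
    with Cons.prems have x: "x \<in> S" and w: "w \<in> words S" by auto
    have "pres_class S R [(x, True)] \<otimes>\<^bsub>?G\<^esub> pres_class S R [(x, False)] = \<one>\<^bsub>?G\<^esub>"
      using pres_eq.cancel[of x S "[]" "[]" R True] x
      by (simp add: mult_pres_class one_presented_group pres_class_eq_iff)
    then have "inv\<^bsub>?G\<^esub> pres_class S R [(x, True)] = pres_class S R [(x, False)]"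
      using x by (intro inv_equality) (auto simp: carrier_presented_group inv_comm)
    then have "pres_class S R [a] \<in> generate ?G ?gens"
      using x by (cases b) (auto simp: a intro: generate.incl dest: generate.inv[of _ ?gens ?G, OF imageI])
    then have "pres_class S R [a] \<otimes>\<^bsub>?G\<^esub> pres_class S R w \<in> generate ?G ?gens"
      using Cons.IH[OF w] by (rule generate.eng)
    then show ?case using x w by (simp add: a mult_pres_class)
  qed
  then show "carrier ?G \<subseteq> generate ?G ?gens"
    by (auto simp: carrier_presented_group)
qed

context group
begin

lemma eval_word_closed:
  assumes "f \<in> S \<rightarrow> carrier G" and "w \<in> words S"
  shows "eval_word G f w \<in> carrier G"
  using assms(2)
proof (induction w)
  case (Cons a w)
  with assms(1) show ?case by (cases a) (auto simp: eval_word_def Pi_iff)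
qed (simp add: eval_word_def)

lemma eval_word_append:
  assumes "f \<in> S \<rightarrow> carrier G" and "u \<in> words S" and "v \<in> words S"
  shows "eval_word G f (u @ v) = eval_word G f u \<otimes> eval_word G f v"
  using assms(2)
proof (induction u)
  case Nil
  then show ?case using eval_word_closed[OF assms(1,3)] by (simp add: eval_word_def)
next
  case (Cons a u)
  obtain x b where a: "a = (x, b)" by fastforce
  with Cons.prems have x: "x \<in> S" and u: "u \<in> words S" by auto
  show ?case
    using x assms(1) Cons.IH[OF u] eval_word_closed[OF assms(1) u] eval_word_closed[OF assms(1,3)]
    by (auto simp: a eval_word_def Pi_iff m_assoc)
qed

lemma eval_word_pres_eq:
  assumes f: "f \<in> S \<rightarrow> carrier G"
    and rel: "\<And>r s. (r, s) \<in> R \<Longrightarrow> eval_word G f r = eval_word G f s"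
    and "pres_eq S R v w"
  shows "eval_word G f v = eval_word G f w"
  using assms(3)
proof induction
  case (cancel x u v b)
  have "f x \<in> carrier G" using f cancel by auto
  then have "eval_word G f [(x, b), (x, \<not> b)] = \<one>"
    by (auto simp: eval_word_def)
  moreover have "eval_word G f (u @ [(x, b), (x, \<not> b)] @ v) =
      eval_word G f u \<otimes> (eval_word G f [(x, b), (x, \<not> b)] \<otimes> eval_word G f v)"
    using cancel eval_word_append[OF f, of u "[(x, b), (x, \<not> b)] @ v"]
      eval_word_append[OF f, of "[(x, b), (x, \<not> b)]" v] by simp
  ultimately show ?case
    using cancel eval_word_closed[OF f] by (simp add: eval_word_append[OF f])
next
  case (relation r s u v)
  then show ?case by (simp add: eval_word_append[OF f] rel)
qed auto

lemma pres_lift_class: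
  assumes "f \<in> S \<rightarrow> carrier G"
    and "\<And>r s. (r, s) \<in> R \<Longrightarrow> eval_word G f r = eval_word G f s"
    and "w \<in> words S"
  shows "pres_lift G f (pres_class S R w) = eval_word G f w"
proof -
  have "eval_word G f ` pres_class S R w = {eval_word G f w}"
    using assms(3) eval_word_pres_eq[OF assms(1,2)]
    by (fastforce simp: pres_class_def intro: pres_eq.refl)
  then show ?thesis by (simp add: pres_lift_def)
qed

lemma pres_lift_hom:
  assumes "f \<in> S \<rightarrow> carrier G"
    and "\<And>r s. (r, s) \<in> R \<Longrightarrow> eval_word G f r = eval_word G f s"
  shows "pres_lift G f \<in> hom (presented_group S R) G"
  by (rule homI) (auto simp: carrier_presented_group mult_pres_class
      pres_lift_class[OF assms] eval_word_closed[OF assms(1)] eval_word_append[OF assms(1)])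

lemma pres_lift_generator:
  assumes "f \<in> S \<rightarrow> carrier G"
    and "\<And>r s. (r, s) \<in> R \<Longrightarrow> eval_word G f r = eval_word G f s"
    and "x \<in> S"
  shows "pres_lift G f (pres_class S R [(x, True)]) = f x"
proof -
  have "f x \<in> carrier G" using assms(1,3) by blast
  then show ?thesis
    using assms(3) by (subst pres_lift_class[OF assms(1,2)]) (auto simp: eval_word_def)
qed

end


section \<open>The bar complex in low degrees\<close>

text \<open>Functions on homology classes are written as \<open>the_elem\<close> of the image of a coset; this evaluates them
  at any representative.\<close>

lemma the_elem_image_constant:
  assumes "z \<in> U" and "\<And>y. y \<in> U \<Longrightarrow> f y = v"
  shows "the_elem (f ` U) = v"
proof -
  have "f ` U = {v}" using assms by auto
  then show ?thesis by simp
qed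

lemma hom_free_Abelian_group_eqI:
  assumes "group H" and f: "f \<in> hom (free_Abelian_group S) H" and g: "g \<in> hom (free_Abelian_group S) H"
    and eq: "\<And>x. x \<in> S \<Longrightarrow> f (frag_of x) = g (frag_of x)"
    and x: "x \<in> carrier (free_Abelian_group S)"
  shows "f x = g x"
proof -
  interpret f: group_hom "free_Abelian_group S" H f
    using assms by (simp add: group_hom_def group_hom_axioms_def)
  interpret g: group_hom "free_Abelian_group S" H g
    using assms by (simp add: group_hom_def group_hom_axioms_def)
  from x have "Poly_Mapping.keys x \<subseteq> S" by simp
  then show ?thesis
  proof (induction rule: free_Abelian_group_induct[consumes 1, case_names zero diff basis])
    case zero
    then show ?case using f.hom_one g.hom_one by simp
  next
    case (diff x y)
    then have *: "h (x - y) = h x \<otimes>\<^bsub>H\<^esub> inv\<^bsub>H\<^esub> h y" if "h \<in> hom (free_Abelian_group S) H" for h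
    proof -
      interpret h: group_hom "free_Abelian_group S" H h
        using assms(1) that by (simp add: group_hom_def group_hom_axioms_def)
      show ?thesis
        using diff h.hom_mult[of x "- y"] h.hom_inv[of y] by simp
    qed
    show ?case unfolding *[OF f] *[OF g] diff(3,4) ..
  qed (use eq in simp)
qed

lemma carrier_bar_chain_group: "z \<in> carrier (bar_chain_group n G) \<longleftrightarrow> Poly_Mapping.keys z \<subseteq> bar_basis n G"
  by (simp add: bar_chain_group_def)

lemma mult_bar_chain_group: "y \<otimes>\<^bsub>bar_chain_group n G\<^esub> z = y + z"
  by (simp add: bar_chain_group_def)

lemma comm_group_bar_chain_group: "comm_group (bar_chain_group n G)"
  by (simp add: bar_chain_group_def abelian_free_Abelian_group)

lemma inv_bar_chain_group:
  "z \<in> carrier (bar_chain_group n G) \<Longrightarrow> inv\<^bsub>bar_chain_group n G\<^esub> z = - z"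
  by (simp add: bar_chain_group_def)

lemma bar_chain_group_closed:
  assumes "y \<in> carrier (bar_chain_group n G)" and "z \<in> carrier (bar_chain_group n G)"
  shows "y + z \<in> carrier (bar_chain_group n G)" and "y - z \<in> carrier (bar_chain_group n G)"
    and "- z \<in> carrier (bar_chain_group n G)"
  using assms keys_add[of y z] keys_diff[of y z] by (auto simp: carrier_bar_chain_group)

lemma bar_basis_1: "bar_basis (Suc 0) G = (\<lambda>g. [g]) ` carrier G"
  by (auto simp: bar_basis_def length_Suc_conv)

lemma bar_basis_2: "bar_basis 2 G = {[g, h] | g h. g \<in> carrier G \<and> h \<in> carrier G}"
  by (auto simp: bar_basis_def numeral_eq_Suc length_Suc_conv)

lemma bar_basis_3:
  "bar_basis 3 G = {[g, h, k] | g h k. g \<in> carrier G \<and> h \<in> carrier G \<and> k \<in> carrier G}"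
  by (auto simp: bar_basis_def numeral_eq_Suc length_Suc_conv)

lemma frag_of_1_chain: "frag_of [g] \<in> carrier (bar_chain_group (Suc 0) G) \<longleftrightarrow> g \<in> carrier G"
  by (auto simp: carrier_bar_chain_group bar_basis_1)

lemma frag_of_2_chain:
  "frag_of [g, h] \<in> carrier (bar_chain_group 2 G) \<longleftrightarrow> g \<in> carrier G \<and> h \<in> carrier G"
  by (auto simp: carrier_bar_chain_group bar_basis_2)

lemma frag_of_3_chain:
  "frag_of [g, h, k] \<in> carrier (bar_chain_group 3 G) \<longleftrightarrow>
    g \<in> carrier G \<and> h \<in> carrier G \<and> k \<in> carrier G"
  by (auto simp: carrier_bar_chain_group bar_basis_3)

lemmas bar_boundary_add = frag_extend_add[where f = "bar_boundary_basis G" for G, folded bar_boundary_def]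
lemmas bar_boundary_diff = frag_extend_diff[where f = "bar_boundary_basis G" for G, folded bar_boundary_def]
lemmas bar_boundary_minus = frag_extend_minus[where f = "bar_boundary_basis G" for G, folded bar_boundary_def]

lemma bar_boundary_0 [simp]: "bar_boundary G 0 = 0"
  by (simp add: bar_boundary_def)

lemma bar_boundary_2:
  "bar_boundary G (frag_of [g, h]) = frag_of [h] - frag_of [g \<otimes>\<^bsub>G\<^esub> h] + frag_of [g]"
  by (simp add: bar_boundary_def bar_boundary_basis_def)

lemma bar_boundary_3:
  "bar_boundary G (frag_of [g, h, k]) =
    frag_of [h, k] - frag_of [g \<otimes>\<^bsub>G\<^esub> h, k] + frag_of [g, h \<otimes>\<^bsub>G\<^esub> k] - frag_of [g, h]"
  by (simp add: bar_boundary_def bar_boundary_basis_def numeral_eq_Suc)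

lemma bar_chain_induct [consumes 1, case_names zero diff basis]:
  assumes "z \<in> carrier (bar_chain_group n G)"
    and "P 0"
    and "\<And>y z. y \<in> carrier (bar_chain_group n G) \<Longrightarrow> z \<in> carrier (bar_chain_group n G) \<Longrightarrow>
      P y \<Longrightarrow> P z \<Longrightarrow> P (y - z)"
    and "\<And>gs. gs \<in> bar_basis n G \<Longrightarrow> P (frag_of gs)"
  shows "P z"
  using free_Abelian_group_induct[of z "bar_basis n G" P] assms
  by (auto simp: carrier_bar_chain_group)

lemma carrier_cycle_group:
  "z \<in> carrier (cycle_group n G) \<longleftrightarrow> z \<in> carrier (bar_chain_group n G) \<and> bar_boundary G z = 0"
  by (simp add: cycle_group_def)

lemma mult_cycle_group: "y \<otimes>\<^bsub>cycle_group n G\<^esub> z = y + z"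
  by (simp add: cycle_group_def mult_bar_chain_group)

lemma subgroup_cycles: "subgroup (carrier (cycle_group n G)) (bar_chain_group n G)"
proof -
  interpret comm_group "bar_chain_group n G" by (rule comm_group_bar_chain_group)
  have "0 \<in> carrier (cycle_group n G)"
    by (simp add: carrier_cycle_group carrier_bar_chain_group)
  then have "carrier (cycle_group n G) \<noteq> {}" by blast
  then show ?thesis
    by (intro subgroupI subsetI)
      (auto simp: carrier_cycle_group inv_bar_chain_group mult_bar_chain_group bar_chain_group_closed
        bar_boundary_add bar_boundary_minus)
qed

lemma comm_group_cycle_group: "comm_group (cycle_group n G)"
proof -
  interpret comm_group "bar_chain_group n G" by (rule comm_group_bar_chain_group)
  have "cycle_group n G = (bar_chain_group n G)\<lparr>carrier := carrier (cycle_group n G)\<rparr>"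
    by (simp add: cycle_group_def)
  then have "group (cycle_group n G)"
    using subgroup.subgroup_is_group[OF subgroup_cycles is_group] by metis
  then show ?thesis
    by (rule group.group_comm_groupI) (simp add: mult_cycle_group add.commute)
qed

lemma inv_cycle_group: "z \<in> carrier (cycle_group n G) \<Longrightarrow> inv\<^bsub>cycle_group n G\<^esub> z = - z"
proof -
  interpret comm_group "cycle_group n G" by (rule comm_group_cycle_group)
  assume z: "z \<in> carrier (cycle_group n G)"
  moreover have "\<one>\<^bsub>cycle_group n G\<^esub> = 0"
    by (simp add: cycle_group_def bar_chain_group_def)
  ultimately show ?thesis
    by (intro inv_equality)
      (auto simp: carrier_cycle_group mult_cycle_group bar_chain_group_closed bar_boundary_minus)
qed

lemma boundaries_closed:
  assumes "a \<in> boundaries n G" and "b \<in> boundaries n G"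
  shows "a + b \<in> boundaries n G" and "a - b \<in> boundaries n G" and "- b \<in> boundaries n G"
proof -
  obtain u v where u: "u \<in> carrier (bar_chain_group (Suc n) G)" "a = bar_boundary G u"
    and v: "v \<in> carrier (bar_chain_group (Suc n) G)" "b = bar_boundary G v"
    using assms by (auto simp: boundaries_def)
  note closed = bar_chain_group_closed[OF u(1) v(1)]
  show "a + b \<in> boundaries n G" "a - b \<in> boundaries n G" "- b \<in> boundaries n G"
    unfolding boundaries_def u(2) v(2) bar_boundary_add[symmetric] bar_boundary_diff[symmetric]
      bar_boundary_minus[symmetric]
    by (intro imageI closed)+
qed

lemma zero_in_boundaries: "0 \<in> boundaries n G"
  unfolding boundaries_def
  by (rule image_eqI[of _ _ 0]) (auto simp: carrier_bar_chain_group)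

lemma homology_class_eq_image: "homology_class n G z = (\<lambda>b. b + z) ` boundaries n G"
  by (auto simp: homology_class_def r_coset_def mult_cycle_group)

lemma in_own_homology_class: "z \<in> homology_class n G z"
  using zero_in_boundaries by (force simp: homology_class_eq_image)

lemma homology_class_eqI:
  assumes "y - z \<in> boundaries n G"
  shows "homology_class n G y = homology_class n G z"
proof -
  have "b + y \<in> homology_class n G z" if "b \<in> boundaries n G" for b
    using boundaries_closed(1)[OF that assms]
    by (force simp: homology_class_eq_image)
  moreover have "b + z \<in> homology_class n G y" if "b \<in> boundaries n G" for b
    using boundaries_closed(2)[OF that assms]
    by (force simp: homology_class_eq_image)
  ultimately show ?thesis
    by (auto simp: homology_class_eq_image[of n G y] homology_class_eq_image[of n G z])
qed

context group
begin

text \<open>The twelve terms of the iterated boundary cancel in pairs, \<open>[(g h) k]\<close> against \<open>[g (h k)]\<close> by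
  associativity.\<close>

lemma boundary_of_basis_3_is_cycle:
  assumes "g \<in> carrier G" and "h \<in> carrier G" and "k \<in> carrier G"
  shows "bar_boundary G (frag_of [g, h, k]) \<in> carrier (cycle_group 2 G)"
  using assms
  by (auto simp: bar_boundary_3 carrier_cycle_group frag_of_2_chain bar_boundary_add bar_boundary_diff
      bar_boundary_2 m_assoc algebra_simps intro!: bar_chain_group_closed)

lemma boundaries_are_cycles: "boundaries 2 G \<subseteq> carrier (cycle_group 2 G)"
proof -
  have "bar_boundary G z \<in> carrier (cycle_group 2 G)"
    if "z \<in> carrier (bar_chain_group 3 G)" for z
    using that
  proof (induction rule: bar_chain_induct)
    case zero
    then show ?case by (simp add: carrier_cycle_group carrier_bar_chain_group)
  next
    case (diff y z)
    then show ?case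
      by (auto simp: carrier_cycle_group bar_boundary_diff bar_chain_group_closed)
  next
    case (basis gs)
    then show ?case
      by (auto simp: bar_basis_3 boundary_of_basis_3_is_cycle)
  qed
  then show ?thesis
    by (auto simp: boundaries_def numeral_eq_Suc)
qed

lemma normal_boundaries: "boundaries 2 G \<lhd> cycle_group 2 G"
proof -
  interpret Z: comm_group "cycle_group 2 G" by (rule comm_group_cycle_group)
  have "subgroup (boundaries 2 G) (cycle_group 2 G)"
    using boundaries_are_cycles zero_in_boundaries
    by (intro Z.subgroupI) (auto simp: mult_cycle_group inv_cycle_group boundaries_closed subset_iff)
  then show ?thesis
    by (simp add: Z.normal_iff_subgroup)
qed

lemma carrier_homology_2: "carrier (homology 2 G) = homology_class 2 G ` carrier (cycle_group 2 G)"
  by (simp add: homology_def carrier_FactGroup homology_class_def)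

lemma comm_group_homology_2: "comm_group (homology 2 G)"
  unfolding homology_def
  using normal_boundaries comm_group.abelian_FactGroup[OF comm_group_cycle_group] normal_imp_subgroup
  by blast

lemma homology_class_hom: "homology_class 2 G \<in> hom (cycle_group 2 G) (homology 2 G)"
  unfolding homology_def homology_class_def[abs_def]
  by (rule normal.r_coset_hom_Mod[OF normal_boundaries])

end

subsection \<open>Pontryagin products as bar cycles\<close>

lemma bar_chain_map_3:
  assumes f: "f \<in> hom G H" and "z \<in> carrier (bar_chain_group 3 G)"
  shows "frag_extend (\<lambda>gs. frag_of (map f gs)) z \<in> carrier (bar_chain_group 3 H)"
    and "frag_extend (\<lambda>gs. frag_of (map f gs)) (bar_boundary G z) =
      bar_boundary H (frag_extend (\<lambda>gs. frag_of (map f gs)) z)"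
proof -
  show "frag_extend (\<lambda>gs. frag_of (map f gs)) z \<in> carrier (bar_chain_group 3 H)"
    using assms(2)
  proof (induction rule: bar_chain_induct)
    case (basis gs)
    then show ?case using hom_in_carrier[OF f] by (auto simp: bar_basis_3 frag_of_3_chain)
  qed (auto simp: frag_extend_diff bar_chain_group_closed, simp add: carrier_bar_chain_group)
  show "frag_extend (\<lambda>gs. frag_of (map f gs)) (bar_boundary G z) =
      bar_boundary H (frag_extend (\<lambda>gs. frag_of (map f gs)) z)"
    using assms(2)
  proof (induction rule: bar_chain_induct)
    case (basis gs)
    then show ?case
      by (auto simp: bar_basis_3 bar_boundary_3 frag_extend_add frag_extend_diff hom_mult[OF f])
  qed (auto simp: frag_extend_diff bar_boundary_diff)
qed

text \<open>A homomorphism induces a map of chains that commutes with the boundary of 3-chains, so all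
  representatives of a class have homologous images.\<close>

lemma homology_map_class:
  assumes "f \<in> hom G H"
  shows "homology_map 2 H f (homology_class 2 G z) =
    homology_class 2 H (frag_extend (\<lambda>gs. frag_of (map f gs)) z)"
proof -
  let ?F = "frag_extend (\<lambda>gs. frag_of (map f gs))"
  have "?F b \<in> boundaries 2 H" if "b \<in> boundaries 2 G" for b
    using that bar_chain_map_3[OF assms] by (auto simp: boundaries_def numeral_eq_Suc)
  then have "homology_class 2 H (?F (b + z)) = homology_class 2 H (?F z)"
    if "b \<in> boundaries 2 G" for b
    using that by (intro homology_class_eqI) (simp add: frag_extend_add)
  then show ?thesis
    unfolding homology_map_def
    by (intro the_elem_image_constant[OF in_own_homology_class]) (auto simp: homology_class_eq_image)
qed

lemma (in group) int_pow_commutes: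
  assumes "x \<otimes> y = y \<otimes> x" and "x \<in> carrier G" and "y \<in> carrier G"
  shows "x [^] (n :: int) \<otimes> y = y \<otimes> x [^] n"
proof (cases n rule: int_cases2)
  case (nonneg k)
  then show ?thesis using assms by (simp add: int_pow_int group_commutes_pow)
next
  case (nonpos k)
  have "x [^] k \<otimes> y = y \<otimes> x [^] k"
    using assms by (rule group_commutes_pow)
  then have "inv (x [^] k) \<otimes> y = y \<otimes> inv (x [^] k)"
    using assms(2,3) by (intro inv_solve_left'[THEN iffD2]) (auto simp: m_assoc[symmetric] inv_solve_right)
  then show ?thesis using nonpos assms by (simp add: int_pow_neg_int)
qed

lemma (in group) int_pow_pair_hom:
  assumes "g \<in> carrier G" and "h \<in> carrier G" and "g \<otimes> h = h \<otimes> g"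
  shows "(\<lambda>(m :: int, n :: int). g [^] m \<otimes> h [^] n) \<in> hom (integer_group \<times>\<times> integer_group) G"
proof (rule homI)
  fix a b :: "int \<times> int"
  obtain m n m' n' where ab: "a = (m, n)" "b = (m', n')" by fastforce
  have "h [^] n \<otimes> g [^] m' = g [^] m' \<otimes> h [^] n"
    using assms by (intro int_pow_commutes int_pow_commutes[symmetric]) auto
  then show "(case a \<otimes>\<^bsub>integer_group \<times>\<times> integer_group\<^esub> b of (m, n) \<Rightarrow> g [^] m \<otimes> h [^] n) =
      (case a of (m, n) \<Rightarrow> g [^] m \<otimes> h [^] n) \<otimes> (case b of (m, n) \<Rightarrow> g [^] m \<otimes> h [^] n)"
    using assms(1,2) by (simp add: ab int_pow_mult m_assoc) (simp add: m_assoc[symmetric])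
qed (use assms in auto)

text \<open>The homomorphism sends \<open>(1, 0)\<close> to \<open>g\<close> and \<open>(0, 1)\<close> to \<open>h\<close>, so it sends the torus cycle to the
  expected cycle symbol by symbol.\<close>

lemma (in group) pontryagin_eq:
  assumes "g \<in> carrier G" and "h \<in> carrier G" and "g \<otimes> h = h \<otimes> g"
  shows "pontryagin G g h = homology_class 2 G (frag_of [g, h] - frag_of [h, g])"
  unfolding pontryagin_def torus_class_def
  using assms by (simp add: homology_map_class[OF int_pow_pair_hom] frag_extend_diff int_pow_1)

lemma (in group) pontryagin_cycle:
  assumes "g \<in> carrier G" and "h \<in> carrier G" and "g \<otimes> h = h \<otimes> g"
  shows "frag_of [g, h] - frag_of [h, g] \<in> carrier (cycle_group 2 G)"
  using assms by (auto simp: carrier_cycle_group frag_of_2_chain bar_boundary_diff bar_boundary_2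
      intro!: bar_chain_group_closed)

section \<open>Evaluation of cochains on chains\<close>

text \<open>The product defining the evaluation may be taken over any finite set of symbols that contains the
  support.  Over the union of two supports it is visibly multiplicative.\<close>

lemma eval_on_chain_hom:
  assumes "comm_group A" and c: "\<And>g h. g \<in> carrier G \<Longrightarrow> h \<in> carrier G \<Longrightarrow> c g h \<in> carrier A"
  shows "eval_on_chain A c \<in> hom (bar_chain_group 2 G) A"
proof -
  interpret A: comm_group A by fact
  have eq: "eval_on_chain A c z =
      finprod A (\<lambda>gs. c (gs ! 0) (gs ! 1) [^]\<^bsub>A\<^esub> Poly_Mapping.lookup z gs) T"
    if "Poly_Mapping.keys z \<subseteq> T" "finite T" "T \<subseteq> bar_basis 2 G" for z T
    unfolding eval_on_chain_def
    using that c
    by (intro A.finprod_mono_neutral_cong_left) (auto simp: in_keys_iff bar_basis_2)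
  show ?thesis
  proof (rule homI)
    fix z assume "z \<in> carrier (bar_chain_group 2 G)"
    then show "eval_on_chain A c z \<in> carrier A"
      using c by (auto simp: eval_on_chain_def carrier_bar_chain_group bar_basis_2 intro!: A.finprod_closed)
  next
    fix y z assume y: "y \<in> carrier (bar_chain_group 2 G)" and z: "z \<in> carrier (bar_chain_group 2 G)"
    let ?T = "Poly_Mapping.keys y \<union> Poly_Mapping.keys z"
    let ?c = "\<lambda>gs. c (gs ! 0) (gs ! 1)"
    have T: "finite ?T" "?T \<subseteq> bar_basis 2 G" "Poly_Mapping.keys (y + z) \<subseteq> ?T"
      using y z keys_add[of y z] by (auto simp: carrier_bar_chain_group)
    have cT: "?c gs \<in> carrier A" if "gs \<in> ?T" for gs
      using that T(2) c by (auto simp: bar_basis_2 subset_iff)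
    have "eval_on_chain A c (y + z) = finprod A (\<lambda>gs. ?c gs [^]\<^bsub>A\<^esub> Poly_Mapping.lookup (y + z) gs) ?T"
      using T by (rule_tac eq)
    also have "\<dots> = finprod A (\<lambda>gs. ?c gs [^]\<^bsub>A\<^esub> Poly_Mapping.lookup y gs \<otimes>\<^bsub>A\<^esub>
        ?c gs [^]\<^bsub>A\<^esub> Poly_Mapping.lookup z gs) ?T"
      using cT by (intro A.finprod_cong) (auto simp: simp_implies_def lookup_add A.int_pow_mult)
    also have "\<dots> = eval_on_chain A c y \<otimes>\<^bsub>A\<^esub> eval_on_chain A c z"
      using cT T by (subst A.finprod_multf) (auto simp: eq[of y ?T] eq[of z ?T])
    finally show "eval_on_chain A c (y \<otimes>\<^bsub>bar_chain_group 2 G\<^esub> z) =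
        eval_on_chain A c y \<otimes>\<^bsub>A\<^esub> eval_on_chain A c z"
      by (simp add: mult_bar_chain_group)
  qed
qed

lemma eval_on_chain_frag_of:
  assumes "comm_group A" and "c g h \<in> carrier A"
  shows "eval_on_chain A c (frag_of [g, h]) = c g h"
proof -
  interpret A: comm_group A by fact
  show ?thesis using assms(2) by (simp add: eval_on_chain_def A.int_pow_1)
qed

lemma hom_2_chains_eqI:
  assumes "group D" and "\<mu> \<in> hom (bar_chain_group 2 G) D" and "\<nu> \<in> hom (bar_chain_group 2 G) D"
    and "\<And>g h. g \<in> carrier G \<Longrightarrow> h \<in> carrier G \<Longrightarrow> \<mu> (frag_of [g, h]) = \<nu> (frag_of [g, h])"
    and "z \<in> carrier (bar_chain_group 2 G)"
  shows "\<mu> z = \<nu> z"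
proof (rule hom_free_Abelian_group_eqI[OF assms(1)])
  show "\<mu> \<in> hom (free_Abelian_group (bar_basis 2 G)) D" "\<nu> \<in> hom (free_Abelian_group (bar_basis 2 G)) D"
    "z \<in> carrier (free_Abelian_group (bar_basis 2 G))"
    using assms(2,3,5) unfolding bar_chain_group_def .
  show "\<mu> (frag_of gs) = \<nu> (frag_of gs)" if "gs \<in> bar_basis 2 G" for gs
    using that assms(4) by (auto simp: bar_basis_2)
qed

lemma eval_on_chain_comp_hom:
  assumes "comm_group A" and "comm_group D" and \<nu>: "\<nu> \<in> hom A D"
    and c: "\<And>g h. g \<in> carrier G \<Longrightarrow> h \<in> carrier G \<Longrightarrow> c g h \<in> carrier A"
    and z: "z \<in> carrier (bar_chain_group 2 G)"
  shows "\<nu> (eval_on_chain A c z) = eval_on_chain D (\<lambda>g h. \<nu> (c g h)) z"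
proof -
  have \<nu>c: "\<nu> (c g h) \<in> carrier D" if "g \<in> carrier G" "h \<in> carrier G" for g h
    using c[OF that] hom_in_carrier[OF \<nu>] by simp
  have "(\<lambda>z. \<nu> (eval_on_chain A c z)) \<in> hom (bar_chain_group 2 G) D"
    using hom_compose[OF eval_on_chain_hom[OF assms(1) c] \<nu>] by (simp add: o_def)
  then show ?thesis
  proof (rule hom_2_chains_eqI[OF comm_group.axioms(2)[OF assms(2)] _ eval_on_chain_hom[OF assms(2) \<nu>c] _ z])
    show "\<nu> (eval_on_chain A c (frag_of [g, h])) = eval_on_chain D (\<lambda>g h. \<nu> (c g h)) (frag_of [g, h])"
      if "g \<in> carrier G" "h \<in> carrier G" for g h
      using eval_on_chain_frag_of[OF assms(1), of c] eval_on_chain_frag_of[OF assms(2), of "\<lambda>g h. \<nu> (c g h)"]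
        c[OF that] \<nu>c[OF that] by simp
  qed
qed

lemma hom_comp_boundary:
  assumes "comm_group D" and h: "h \<in> hom (bar_chain_group n G) D"
    and "\<And>gs. gs \<in> bar_basis (Suc n) G \<Longrightarrow> bar_boundary G (frag_of gs) \<in> carrier (bar_chain_group n G)"
  shows "(\<lambda>z. h (bar_boundary G z)) \<in> hom (bar_chain_group (Suc n) G) D"
proof -
  have "bar_boundary G z \<in> carrier (bar_chain_group n G)" if "z \<in> carrier (bar_chain_group (Suc n) G)" for z
    using that
    by (induction rule: bar_chain_induct)
      (auto simp: assms(3) bar_boundary_diff bar_chain_group_closed, simp add: carrier_bar_chain_group)
  then show ?thesis
    using hom_mult[OF h] hom_in_carrier[OF h]
    by (intro homI) (auto simp: mult_bar_chain_group bar_boundary_add)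
qed

text \<open>If \<open>H\<close> extends \<open>\<eta>\<close> to 1-chains, then evaluation of \<open>c\<close> is evaluation of \<open>d\<close> times \<open>H \<circ> \<partial>\<close>: both
  are homomorphisms, and on the symbols \<open>[g|h]\<close> this is the hypothesis.\<close>

lemma (in group) eval_on_chain_cohomologous:
  assumes "comm_group D"
    and c: "\<And>g h. g \<in> carrier G \<Longrightarrow> h \<in> carrier G \<Longrightarrow> c g h \<in> carrier D"
    and d: "\<And>g h. g \<in> carrier G \<Longrightarrow> h \<in> carrier G \<Longrightarrow> d g h \<in> carrier D"
    and \<eta>: "\<And>g. g \<in> carrier G \<Longrightarrow> \<eta> g \<in> carrier D"
    and eq: "\<And>g h. g \<in> carrier G \<Longrightarrow> h \<in> carrier G \<Longrightarrow>
      c g h \<otimes>\<^bsub>D\<^esub> \<eta> (g \<otimes> h) = d g h \<otimes>\<^bsub>D\<^esub> (\<eta> g \<otimes>\<^bsub>D\<^esub> \<eta> h)"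
    and z: "z \<in> carrier (cycle_group 2 G)"
  shows "eval_on_chain D c z = eval_on_chain D d z"
proof -
  interpret D: comm_group D by fact
  have "(\<lambda>gs. \<eta> (hd gs)) ` bar_basis 1 G \<subseteq> carrier D"
    using \<eta> by (auto simp: bar_basis_1)
  then obtain H where H: "H \<in> hom (bar_chain_group 1 G) D"
    and H1: "\<And>gs. gs \<in> bar_basis 1 G \<Longrightarrow> H (frag_of gs) = \<eta> (hd gs)"
    unfolding bar_chain_group_def by (rule D.free_Abelian_group_universal) blast
  have H_of: "H (frag_of [g]) = \<eta> g" if "g \<in> carrier G" for g
    using H1[of "[g]"] that by (simp add: bar_basis_1)
  interpret H: group_hom "bar_chain_group 1 G" D H
    using H comm_group_bar_chain_group by (auto simp: group_hom_def group_hom_axioms_def comm_group_def)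
  have H_diff: "H (a - b + c) = H a \<otimes>\<^bsub>D\<^esub> inv\<^bsub>D\<^esub> H b \<otimes>\<^bsub>D\<^esub> H c"
    if "a \<in> carrier (bar_chain_group 1 G)" "b \<in> carrier (bar_chain_group 1 G)"
      "c \<in> carrier (bar_chain_group 1 G)" for a b c
    using H.hom_mult[of "a - b" c] H.hom_mult[of a "- b"] H.hom_inv[of b] that
    by (simp add: mult_bar_chain_group inv_bar_chain_group bar_chain_group_closed)
  have H_boundary: "H (bar_boundary G (frag_of [g, h])) = \<eta> h \<otimes>\<^bsub>D\<^esub> inv\<^bsub>D\<^esub> \<eta> (g \<otimes> h) \<otimes>\<^bsub>D\<^esub> \<eta> g"
    if "g \<in> carrier G" "h \<in> carrier G" for g h
    using that frag_of_1_chain[of _ G] by (simp add: bar_boundary_2 H_diff H_of)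
  have 1: "(\<lambda>z. H (bar_boundary G z)) \<in> hom (bar_chain_group 2 G) D"
    unfolding numeral_2_eq_2 One_nat_def[symmetric]
  proof (rule hom_comp_boundary[OF assms(1) H])
    show "bar_boundary G (frag_of gs) \<in> carrier (bar_chain_group 1 G)"
      if gs: "gs \<in> bar_basis (Suc 1) G" for gs
    proof -
      obtain g h where "gs = [g, h]" "g \<in> carrier G" "h \<in> carrier G"
        using gs by (auto simp: bar_basis_def length_Suc_conv)
      then show ?thesis
        by (simp add: bar_boundary_2 frag_of_1_chain bar_chain_group_closed)
    qed
  qed
  have ed: "eval_on_chain D d \<in> hom (bar_chain_group 2 G) D"
    using assms(1) d by (rule eval_on_chain_hom)
  have dH: "(\<lambda>z. eval_on_chain D d z \<otimes>\<^bsub>D\<^esub> H (bar_boundary G z)) \<in> hom (bar_chain_group 2 G) D"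
    by (rule D.hom_group_mult[OF ed 1])
  have "eval_on_chain D c z = eval_on_chain D d z \<otimes>\<^bsub>D\<^esub> H (bar_boundary G z)"
  proof (rule hom_2_chains_eqI[OF D.is_group eval_on_chain_hom[OF assms(1) c] dH])
    fix g h assume gh: "g \<in> carrier G" "h \<in> carrier G"
    have "d g h \<otimes>\<^bsub>D\<^esub> (\<eta> h \<otimes>\<^bsub>D\<^esub> inv\<^bsub>D\<^esub> \<eta> (g \<otimes> h) \<otimes>\<^bsub>D\<^esub> \<eta> g) =
        d g h \<otimes>\<^bsub>D\<^esub> (\<eta> g \<otimes>\<^bsub>D\<^esub> \<eta> h) \<otimes>\<^bsub>D\<^esub> inv\<^bsub>D\<^esub> \<eta> (g \<otimes> h)"
      using gh d \<eta> by (simp add: D.m_ac)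
    also have "\<dots> = c g h"
      using gh c \<eta> by (simp add: eq[symmetric] D.m_assoc)
    finally show "eval_on_chain D c (frag_of [g, h]) =
        eval_on_chain D d (frag_of [g, h]) \<otimes>\<^bsub>D\<^esub> H (bar_boundary G (frag_of [g, h]))"
      using gh c d assms(1) by (simp add: eval_on_chain_frag_of H_boundary)
  qed (use z in \<open>auto simp: carrier_cycle_group\<close>)
  also have "\<dots> = eval_on_chain D d z"
    using z hom_in_carrier[OF ed, of z] H.hom_one
    by (simp add: carrier_cycle_group bar_chain_group_def)
  finally show ?thesis .
qed

lemma two_cocycleD:
  assumes "two_cocycle G A c" and "g \<in> carrier G" and "h \<in> carrier G"
  shows "c g h \<in> carrier A"
    and "k \<in> carrier G \<Longrightarrow>
      c g h \<otimes>\<^bsub>A\<^esub> c (g \<otimes>\<^bsub>G\<^esub> h) k = c h k \<otimes>\<^bsub>A\<^esub> c g (h \<otimes>\<^bsub>G\<^esub> k)"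
  using assms by (auto simp: two_cocycle_def)

context group
begin

text \<open>The cocycle identity at \<open>(g, h, k)\<close> says exactly that \<open>c\<close> is trivial on the boundary of \<open>[g|h|k]\<close>.\<close>

lemma eval_on_boundary:
  assumes "comm_group A" and c: "two_cocycle G A c" and "b \<in> boundaries 2 G"
  shows "eval_on_chain A c b = \<one>\<^bsub>A\<^esub>"
proof -
  interpret A: comm_group A by fact
  have e: "eval_on_chain A c \<in> hom (bar_chain_group 2 G) A"
    using eval_on_chain_hom[OF assms(1) two_cocycleD(1)[OF c]] .
  interpret e: group_hom "bar_chain_group 2 G" A "eval_on_chain A c"
    using e comm_group_bar_chain_group by (auto simp: group_hom_def group_hom_axioms_def comm_group_def)
  have diff: "eval_on_chain A c (x - y) = eval_on_chain A c x \<otimes>\<^bsub>A\<^esub> inv\<^bsub>A\<^esub> eval_on_chain A c y"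
    if "x \<in> carrier (bar_chain_group 2 G)" "y \<in> carrier (bar_chain_group 2 G)" for x y
    using e.hom_mult[of x "- y"] e.hom_inv[of y] that
    by (simp add: mult_bar_chain_group inv_bar_chain_group bar_chain_group_closed)
  obtain z where z: "z \<in> carrier (bar_chain_group 3 G)" and b: "b = bar_boundary G z"
    using assms(3) by (auto simp: boundaries_def numeral_eq_Suc)
  have "bar_boundary G z \<in> carrier (bar_chain_group 2 G) \<and> eval_on_chain A c (bar_boundary G z) = \<one>\<^bsub>A\<^esub>"
    using z
  proof (induction rule: bar_chain_induct)
    case zero
    then show ?case using e.hom_one by (simp add: bar_chain_group_def)
  next
    case (diff y z)
    then show ?case by (simp add: bar_boundary_diff bar_chain_group_closed \<open>\<And>x y. _ \<Longrightarrow> _ \<Longrightarrow> eval_on_chain A c (x - y) = _\<close>)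
  next
    case (basis gs)
    then obtain g h k where gs: "gs = [g, h, k]" and gh: "g \<in> carrier G" "h \<in> carrier G" "k \<in> carrier G"
      by (auto simp: bar_basis_3)
    note [simp] = two_cocycleD(1)[OF c] frag_of_2_chain bar_chain_group_closed
    have "bar_boundary G (frag_of gs) = (frag_of [h, k] + frag_of [g, h \<otimes> k]) - (frag_of [g, h] + frag_of [g \<otimes> h, k])"
      by (simp add: gs bar_boundary_3)
    moreover have "eval_on_chain A c (frag_of [h, k] + frag_of [g, h \<otimes> k]) = c h k \<otimes>\<^bsub>A\<^esub> c g (h \<otimes> k)"
      "eval_on_chain A c (frag_of [g, h] + frag_of [g \<otimes> h, k]) = c g h \<otimes>\<^bsub>A\<^esub> c (g \<otimes> h) k"
      using e.hom_mult[of "frag_of [h, k]" "frag_of [g, h \<otimes> k]"]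
        e.hom_mult[of "frag_of [g, h]" "frag_of [g \<otimes> h, k]"] gh
      by (simp_all add: mult_bar_chain_group eval_on_chain_frag_of assms(1))
    ultimately show ?case
      using gh two_cocycleD(2)[OF c gh] by (simp add: diff)
  qed
  then show ?thesis by (simp add: b)
qed

lemma eval_cocycle_class:
  assumes "comm_group A" and c: "two_cocycle G A c" and z: "z \<in> carrier (cycle_group 2 G)"
  shows "eval_cocycle A c (homology_class 2 G z) = eval_on_chain A c z"
proof -
  interpret A: comm_group A by fact
  have e: "eval_on_chain A c \<in> hom (bar_chain_group 2 G) A"
    using eval_on_chain_hom[OF assms(1) two_cocycleD(1)[OF c]] .
  have "eval_on_chain A c (b + z) = eval_on_chain A c z" if "b \<in> boundaries 2 G" for b
    using hom_mult[OF e, of b z] hom_in_carrier[OF e, of z] eval_on_boundary[OF assms(1) c that]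
      that boundaries_are_cycles z by (auto simp: carrier_cycle_group mult_bar_chain_group subset_iff)
  then show ?thesis
    unfolding eval_cocycle_def
    by (intro the_elem_image_constant[OF in_own_homology_class]) (auto simp: homology_class_eq_image)
qed

lemma eval_cocycle_hom:
  assumes "comm_group A" and c: "two_cocycle G A c"
  shows "eval_cocycle A c \<in> hom (homology 2 G) A"
proof -
  have e: "eval_on_chain A c \<in> hom (bar_chain_group 2 G) A"
    using eval_on_chain_hom[OF assms(1) two_cocycleD(1)[OF c]] .
  interpret Z: comm_group "cycle_group 2 G" by (rule comm_group_cycle_group)
  show ?thesis
  proof (rule homI)
    fix U V assume "U \<in> carrier (homology 2 G)" "V \<in> carrier (homology 2 G)"
    then obtain y z where y: "y \<in> carrier (cycle_group 2 G)" "U = homology_class 2 G y"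
      and z: "z \<in> carrier (cycle_group 2 G)" "V = homology_class 2 G z"
      by (auto simp: carrier_homology_2)
    have "U \<otimes>\<^bsub>homology 2 G\<^esub> V = homology_class 2 G (y \<otimes>\<^bsub>cycle_group 2 G\<^esub> z)"
      using y z hom_mult[OF homology_class_hom] by simp
    then show "eval_cocycle A c (U \<otimes>\<^bsub>homology 2 G\<^esub> V) = eval_cocycle A c U \<otimes>\<^bsub>A\<^esub> eval_cocycle A c V"
      using y z Z.m_closed[OF y(1) z(1)] hom_mult[OF e, of y z]
      by (simp add: eval_cocycle_class[OF assms] carrier_cycle_group mult_cycle_group mult_bar_chain_group)
  qed (use hom_in_carrier[OF e] in \<open>auto simp: carrier_homology_2 eval_cocycle_class[OF assms] carrier_cycle_group\<close>)
qed

end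

section \<open>Cochains that agree on cycles\<close>

text \<open>The map \<open>s\<close> lifts the homomorphism \<open>g \<mapsto> [g]\<close> from \<open>G\<close> to \<open>H\<^sub>1(G)\<close> to a homomorphism into the
  1-chains.  Such a lift exists when \<open>H\<^sub>1(G)\<close> is free, and having one is a concrete form of the
  vanishing of \<open>Ext(H\<^sub>1(G), D)\<close>.\<close>

definition splits_first_homology :: "('g, 'c) monoid_scheme \<Rightarrow> ('g \<Rightarrow> ('g list \<Rightarrow>\<^sub>0 int)) \<Rightarrow> bool" where
  "splits_first_homology G s \<longleftrightarrow>
    s \<in> hom G (bar_chain_group 1 G) \<and> (\<forall>g \<in> carrier G. frag_of [g] - s g \<in> boundaries 1 G)"

text \<open>This is the injectivity of \<open>H\<^sup>2(G, D) \<rightarrow> Hom(H\<^sub>2(G), D)\<close>.  Choose 2-chains \<open>w g\<close> with boundary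
  \<open>[g] - s g\<close>.  As \<open>s\<close> is additive, \<open>[g|h] + w (g h) - w g - w h\<close> is a cycle.  The evaluations of \<open>c\<close>
  and \<open>d\<close> agree there, so the values of their quotient on the chains \<open>w g\<close> form the required \<open>\<eta>\<close>.\<close>

lemma (in group) agreeing_on_cycles_imp_cohomologous:
  assumes s: "splits_first_homology G s" and D: "comm_group D"
    and c: "\<And>g h. g \<in> carrier G \<Longrightarrow> h \<in> carrier G \<Longrightarrow> c g h \<in> carrier D"
    and d: "\<And>g h. g \<in> carrier G \<Longrightarrow> h \<in> carrier G \<Longrightarrow> d g h \<in> carrier D"
    and eq: "\<And>z. z \<in> carrier (cycle_group 2 G) \<Longrightarrow> eval_on_chain D c z = eval_on_chain D d z"
  shows "\<exists>\<eta>. (\<forall>g \<in> carrier G. \<eta> g \<in> carrier D) \<and>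
    (\<forall>g \<in> carrier G. \<forall>h \<in> carrier G.
      c g h \<otimes>\<^bsub>D\<^esub> \<eta> (g \<otimes> h) = d g h \<otimes>\<^bsub>D\<^esub> (\<eta> g \<otimes>\<^bsub>D\<^esub> \<eta> h))"
proof -
  interpret D: comm_group D by fact
  have "\<exists>w. \<forall>g\<in>carrier G. w g \<in> carrier (bar_chain_group 2 G) \<and> bar_boundary G (w g) = frag_of [g] - s g"
    using s by (intro bchoice) (force simp: splits_first_homology_def boundaries_def numeral_2_eq_2)
  then obtain w where w: "\<And>g. g \<in> carrier G \<Longrightarrow> w g \<in> carrier (bar_chain_group 2 G)"
    and bw: "\<And>g. g \<in> carrier G \<Longrightarrow> bar_boundary G (w g) = frag_of [g] - s g"
    by blast
  define \<epsilon> where "\<epsilon> z = eval_on_chain D c z \<otimes>\<^bsub>D\<^esub> inv\<^bsub>D\<^esub> eval_on_chain D d z" for z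
  have ec: "eval_on_chain D c \<in> hom (bar_chain_group 2 G) D"
    using D c by (rule eval_on_chain_hom)
  have ed: "eval_on_chain D d \<in> hom (bar_chain_group 2 G) D"
    using D d by (rule eval_on_chain_hom)
  have \<epsilon>: "\<epsilon> \<in> hom (bar_chain_group 2 G) D"
    using hom_in_carrier[OF ec] hom_in_carrier[OF ed] hom_mult[OF ec] hom_mult[OF ed]
    by (intro homI) (auto simp: \<epsilon>_def D.inv_mult D.m_ac)
  show ?thesis
  proof (intro exI[of _ "\<lambda>g. \<epsilon> (w g)"] conjI ballI)
    show "\<epsilon> (w g) \<in> carrier D" if "g \<in> carrier G" for g
      using hom_in_carrier[OF \<epsilon> w[OF that]] .
    fix g h assume gh: "g \<in> carrier G" "h \<in> carrier G"
    let ?gh = "frag_of [g, h]"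
    have gh2: "?gh \<in> carrier (bar_chain_group 2 G)" using gh by (simp add: frag_of_2_chain)
    let ?z = "(?gh + w (g \<otimes> h)) - (w g + w h)"
    have "s (g \<otimes> h) = s g + s h"
      using s gh hom_mult[of s G "bar_chain_group 1 G" g h]
      by (simp add: splits_first_homology_def mult_bar_chain_group)
    then have z: "?z \<in> carrier (cycle_group 2 G)"
      using gh w gh2 by (simp add: carrier_cycle_group bar_chain_group_closed bar_boundary_add
          bar_boundary_diff bar_boundary_2 bw)
    then have "\<epsilon> ?z = \<one>\<^bsub>D\<^esub>"
      using eq[OF z] hom_in_carrier[OF ed] by (simp add: \<epsilon>_def carrier_cycle_group)
    moreover have "\<epsilon> ?z \<otimes>\<^bsub>D\<^esub> \<epsilon> (w g + w h) = \<epsilon> (?gh + w (g \<otimes> h))"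
      using hom_mult[OF \<epsilon>, of ?z "w g + w h"] z w gh
      by (simp add: mult_bar_chain_group carrier_cycle_group bar_chain_group_closed)
    ultimately have "\<epsilon> (?gh + w (g \<otimes> h)) = \<epsilon> (w g + w h)"
      using hom_in_carrier[OF \<epsilon>, of "w g + w h"] w gh by (simp add: bar_chain_group_closed)
    then have "\<epsilon> ?gh \<otimes>\<^bsub>D\<^esub> \<epsilon> (w (g \<otimes> h)) = \<epsilon> (w g) \<otimes>\<^bsub>D\<^esub> \<epsilon> (w h)"
      using hom_mult[OF \<epsilon>, of "w g" "w h"] hom_mult[OF \<epsilon>, of ?gh "w (g \<otimes> h)"] w gh gh2
      by (simp add: mult_bar_chain_group)
    moreover have "\<epsilon> ?gh \<otimes>\<^bsub>D\<^esub> d g h = c g h"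
      using gh c d by (simp add: \<epsilon>_def eval_on_chain_frag_of D D.m_assoc)
    moreover have "\<epsilon> ?gh \<in> carrier D" "\<epsilon> (w (g \<otimes> h)) \<in> carrier D" "\<epsilon> (w g) \<in> carrier D" "\<epsilon> (w h) \<in> carrier D"
      using hom_in_carrier[OF \<epsilon>] gh w gh2 by auto
    ultimately show "c g h \<otimes>\<^bsub>D\<^esub> \<epsilon> (w (g \<otimes> h)) = d g h \<otimes>\<^bsub>D\<^esub> (\<epsilon> (w g) \<otimes>\<^bsub>D\<^esub> \<epsilon> (w h))"
      using d[OF gh] by (metis D.m_assoc D.m_comm)
  qed
qed


section \<open>Central extensions\<close>

subsection \<open>The extension defined by a cocycle\<close>

text \<open>The cocycle identities at \<open>(1, 1, g)\<close> and \<open>(g, 1, 1)\<close>.\<close>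

lemma two_cocycle_one:
  assumes "group G" and "comm_group A" and c: "two_cocycle G A c" and g: "g \<in> carrier G"
  shows "c \<one>\<^bsub>G\<^esub> g = c \<one>\<^bsub>G\<^esub> \<one>\<^bsub>G\<^esub>" and "c g \<one>\<^bsub>G\<^esub> = c \<one>\<^bsub>G\<^esub> \<one>\<^bsub>G\<^esub>"
proof -
  interpret G: group G by fact
  interpret A: comm_group A by fact
  note cl = two_cocycleD(1)[OF c]
  have "c \<one>\<^bsub>G\<^esub> \<one>\<^bsub>G\<^esub> \<otimes>\<^bsub>A\<^esub> c \<one>\<^bsub>G\<^esub> g = c \<one>\<^bsub>G\<^esub> g \<otimes>\<^bsub>A\<^esub> c \<one>\<^bsub>G\<^esub> g"
    using two_cocycleD(2)[OF c, of "\<one>\<^bsub>G\<^esub>" "\<one>\<^bsub>G\<^esub>" g] g by simp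
  then show "c \<one>\<^bsub>G\<^esub> g = c \<one>\<^bsub>G\<^esub> \<one>\<^bsub>G\<^esub>"
    using cl g by (simp add: A.right_cancel)
  have "c g \<one>\<^bsub>G\<^esub> \<otimes>\<^bsub>A\<^esub> c g \<one>\<^bsub>G\<^esub> = c \<one>\<^bsub>G\<^esub> \<one>\<^bsub>G\<^esub> \<otimes>\<^bsub>A\<^esub> c g \<one>\<^bsub>G\<^esub>"
    using two_cocycleD(2)[OF c, of g "\<one>\<^bsub>G\<^esub>" "\<one>\<^bsub>G\<^esub>"] g by simp
  then show "c g \<one>\<^bsub>G\<^esub> = c \<one>\<^bsub>G\<^esub> \<one>\<^bsub>G\<^esub>"
    using cl g by (simp add: A.right_cancel)
qed

lemma mult_cocycle_extension:
  "(a, g) \<otimes>\<^bsub>cocycle_extension G A c\<^esub> (b, h) = (a \<otimes>\<^bsub>A\<^esub> b \<otimes>\<^bsub>A\<^esub> c g h, g \<otimes>\<^bsub>G\<^esub> h)"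
  by (simp add: cocycle_extension_def)

lemma carrier_cocycle_extension: "carrier (cocycle_extension G A c) = carrier A \<times> carrier G"
  by (simp add: cocycle_extension_def)

lemma group_cocycle_extension:
  assumes "group G" and "comm_group A" and c: "two_cocycle G A c"
  shows "group (cocycle_extension G A c)"
proof -
  interpret G: group G by fact
  interpret A: comm_group A by fact
  let ?E = "cocycle_extension G A c"
  note [simp] = two_cocycleD(1)[OF c] mult_cocycle_extension carrier_cocycle_extension
  have one: "\<one>\<^bsub>?E\<^esub> = (inv\<^bsub>A\<^esub> c \<one>\<^bsub>G\<^esub> \<one>\<^bsub>G\<^esub>, \<one>\<^bsub>G\<^esub>)"
    by (simp add: cocycle_extension_def)
  show ?thesis
  proof (rule groupI)
    fix x y z assume "x \<in> carrier ?E" "y \<in> carrier ?E" "z \<in> carrier ?E"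
    then obtain a g b h d k where xyz: "x = (a, g)" "y = (b, h)" "z = (d, k)"
      and abd: "a \<in> carrier A" "b \<in> carrier A" "d \<in> carrier A"
      and ghk: "g \<in> carrier G" "h \<in> carrier G" "k \<in> carrier G"
      by auto
    have "a \<otimes>\<^bsub>A\<^esub> b \<otimes>\<^bsub>A\<^esub> c g h \<otimes>\<^bsub>A\<^esub> d \<otimes>\<^bsub>A\<^esub> c (g \<otimes>\<^bsub>G\<^esub> h) k =
        a \<otimes>\<^bsub>A\<^esub> b \<otimes>\<^bsub>A\<^esub> d \<otimes>\<^bsub>A\<^esub> (c g h \<otimes>\<^bsub>A\<^esub> c (g \<otimes>\<^bsub>G\<^esub> h) k)"
      using abd ghk by (simp add: A.m_ac)
    also have "\<dots> = a \<otimes>\<^bsub>A\<^esub> (b \<otimes>\<^bsub>A\<^esub> d \<otimes>\<^bsub>A\<^esub> c h k) \<otimes>\<^bsub>A\<^esub> c g (h \<otimes>\<^bsub>G\<^esub> k)"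
      using abd ghk by (simp add: two_cocycleD(2)[OF c] A.m_ac)
    finally show "x \<otimes>\<^bsub>?E\<^esub> y \<otimes>\<^bsub>?E\<^esub> z = x \<otimes>\<^bsub>?E\<^esub> (y \<otimes>\<^bsub>?E\<^esub> z)"
      using ghk by (simp add: xyz G.m_assoc)
  next
    fix x assume "x \<in> carrier ?E"
    then obtain a g where x: "x = (a, g)" and a: "a \<in> carrier A" and g: "g \<in> carrier G"
      by auto
    show "\<one>\<^bsub>?E\<^esub> \<otimes>\<^bsub>?E\<^esub> x = x"
      using a g two_cocycle_one(1)[OF assms g] A.m_comm[of "inv\<^bsub>A\<^esub> c \<one>\<^bsub>G\<^esub> \<one>\<^bsub>G\<^esub>" a]
      by (simp add: x one A.m_assoc)
    let ?b = "inv\<^bsub>A\<^esub> c \<one>\<^bsub>G\<^esub> \<one>\<^bsub>G\<^esub> \<otimes>\<^bsub>A\<^esub> inv\<^bsub>A\<^esub> (a \<otimes>\<^bsub>A\<^esub> c (inv\<^bsub>G\<^esub> g) g)"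
    have "(?b, inv\<^bsub>G\<^esub> g) \<otimes>\<^bsub>?E\<^esub> x = \<one>\<^bsub>?E\<^esub>"
      using a g by (simp add: x one A.m_assoc)
    moreover have "(?b, inv\<^bsub>G\<^esub> g) \<in> carrier ?E"
      using a g by simp
    ultimately show "\<exists>y\<in>carrier ?E. y \<otimes>\<^bsub>?E\<^esub> x = \<one>\<^bsub>?E\<^esub>" by blast
  qed (auto simp: one)
qed

subsection \<open>The cocycle of a section\<close>

text \<open>A surjection \<open>p\<close> with central kernel \<open>K\<close>.  The choice of a section turns \<open>E\<close> into the set \<open>K \<times> G\<close>
  with a multiplication twisted by \<open>factor_set\<close>; the \<open>K\<close>-component of an element is its
  \<open>fibre_coordinate\<close>.  The section need not preserve the unit.\<close>

locale central_quotient = E: group E + G: group G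
  for E (structure) and G (structure) +
  fixes p
  assumes p_hom: "p \<in> hom E G"
    and surj: "p ` carrier E = carrier G"
    and central: "\<lbrakk>a \<in> kernel E G p; e \<in> carrier E\<rbrakk> \<Longrightarrow> a \<otimes>\<^bsub>E\<^esub> e = e \<otimes>\<^bsub>E\<^esub> a"
begin

sublocale p: group_hom E G p
  using p_hom by unfold_locales

abbreviation K where "K \<equiv> E\<lparr>carrier := kernel E G p\<rparr>"

definition sec where "sec g = inv_into (carrier E) p g"

definition factor_set where "factor_set g h = sec g \<otimes> sec h \<otimes> inv sec (g \<otimes>\<^bsub>G\<^esub> h)"

definition fibre_coordinate where "fibre_coordinate e = e \<otimes> inv sec (p e)"

lemma kernelI: "e \<in> carrier E \<Longrightarrow> p e = \<one>\<^bsub>G\<^esub> \<Longrightarrow> e \<in> kernel E G p"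
  by (simp add: kernel_def)

lemma kernelD [simp]:
  assumes "a \<in> kernel E G p"
  shows "a \<in> carrier E" and "p a = \<one>\<^bsub>G\<^esub>"
  using assms by (simp_all add: kernel_def)

sublocale K: comm_group K
proof -
  have "group K"
    using p.subgroup_kernel E.is_group by (rule subgroup.subgroup_is_group)
  then show "comm_group K"
  proof (rule group.group_comm_groupI)
    fix a b assume "a \<in> carrier K" "b \<in> carrier K"
    then show "a \<otimes>\<^bsub>K\<^esub> b = b \<otimes>\<^bsub>K\<^esub> a" using central[of a b] by simp
  qed
qed

lemma inv_K: "a \<in> kernel E G p \<Longrightarrow> inv\<^bsub>K\<^esub> a = inv a"
  by (rule E.m_inv_consistent[OF p.subgroup_kernel])

lemma inv_kernel [simp]: "a \<in> kernel E G p \<Longrightarrow> inv a \<in> kernel E G p"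
  by (rule subgroup.m_inv_closed[OF p.subgroup_kernel])

lemma mult_kernel [simp]:
  "a \<in> kernel E G p \<Longrightarrow> b \<in> kernel E G p \<Longrightarrow> a \<otimes> b \<in> kernel E G p"
  by (rule subgroup.m_closed[OF p.subgroup_kernel])

lemma central_extension: "central_extension K E G (\<lambda>a. a) p"
  unfolding central_extension_def
  using p_hom surj central K.comm_group_axioms E.is_group G.is_group
  by (auto simp: hom_def)

lemma sec [simp]:
  assumes "g \<in> carrier G"
  shows "sec g \<in> carrier E" and "p (sec g) = g"
  using assms surj unfolding sec_def by (auto intro: inv_into_into f_inv_into_f)

lemma factor_set_closed [simp]:
  assumes "g \<in> carrier G" and "h \<in> carrier G"
  shows "factor_set g h \<in> kernel E G p"
  using assms by (intro kernelI) (simp_all add: factor_set_def)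

lemma sec_mult:
  assumes "g \<in> carrier G" and "h \<in> carrier G"
  shows "sec g \<otimes> sec h = factor_set g h \<otimes> sec (g \<otimes>\<^bsub>G\<^esub> h)"
  using assms by (simp add: factor_set_def E.m_assoc)

text \<open>Both sides are the fibre coordinate of \<open>sec g sec h sec k\<close>, computed with the two bracketings.\<close>

lemma two_cocycle_factor_set: "two_cocycle G K factor_set"
  unfolding two_cocycle_def
proof (intro conjI ballI)
  fix g h k assume ghk [simp]: "g \<in> carrier G" "h \<in> carrier G" "k \<in> carrier G"
  let ?f = factor_set and ?s = "sec (g \<otimes>\<^bsub>G\<^esub> (h \<otimes>\<^bsub>G\<^esub> k))"
  have "?f g h \<otimes> ?f (g \<otimes>\<^bsub>G\<^esub> h) k \<otimes> ?s = ?f g h \<otimes> (sec (g \<otimes>\<^bsub>G\<^esub> h) \<otimes> sec k)"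
    by (simp add: sec_mult E.m_assoc G.m_assoc)
  also have "\<dots> = sec g \<otimes> (sec h \<otimes> sec k)"
    by (simp add: E.m_assoc[symmetric] sec_mult[symmetric])
  also have "\<dots> = sec g \<otimes> (?f h k \<otimes> sec (h \<otimes>\<^bsub>G\<^esub> k))"
    by (simp add: sec_mult)
  also have "\<dots> = ?f h k \<otimes> (sec g \<otimes> sec (h \<otimes>\<^bsub>G\<^esub> k))"
    using central[of "?f h k" "sec g"] by (simp add: E.m_assoc[symmetric])
  also have "\<dots> = ?f h k \<otimes> ?f g (h \<otimes>\<^bsub>G\<^esub> k) \<otimes> ?s"
    by (simp add: sec_mult E.m_assoc)
  finally show "?f g h \<otimes>\<^bsub>K\<^esub> ?f (g \<otimes>\<^bsub>G\<^esub> h) k = ?f h k \<otimes>\<^bsub>K\<^esub> ?f g (h \<otimes>\<^bsub>G\<^esub> k)"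
    by (simp add: E.right_cancel)
qed simp

lemma fibre_coordinate_closed [simp]: "e \<in> carrier E \<Longrightarrow> fibre_coordinate e \<in> kernel E G p"
  by (intro kernelI) (simp_all add: fibre_coordinate_def)

lemma fibre_coordinate_sec: "e \<in> carrier E \<Longrightarrow> fibre_coordinate e \<otimes> sec (p e) = e"
  by (simp add: fibre_coordinate_def E.m_assoc)

lemma fibre_coordinate_unique:
  assumes "a \<in> kernel E G p" and "g \<in> carrier G"
  shows "fibre_coordinate (a \<otimes> sec g) = a" and "p (a \<otimes> sec g) = g"
proof -
  show "p (a \<otimes> sec g) = g" using assms by simp
  then show "fibre_coordinate (a \<otimes> sec g) = a"
    using assms by (simp add: fibre_coordinate_def E.m_assoc)
qed

lemma fibre_coordinate_mult:
  assumes [simp]: "e \<in> carrier E" "e' \<in> carrier E"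
  shows "fibre_coordinate (e \<otimes> e') =
    fibre_coordinate e \<otimes> fibre_coordinate e' \<otimes> factor_set (p e) (p e')"
proof -
  let ?l = fibre_coordinate
  have "e \<otimes> e' = ?l e \<otimes> sec (p e) \<otimes> (?l e' \<otimes> sec (p e'))"
    by (simp add: fibre_coordinate_sec)
  also have "\<dots> = ?l e \<otimes> ?l e' \<otimes> (sec (p e) \<otimes> sec (p e'))"
  proof -
    have "sec (p e) \<otimes> (?l e' \<otimes> sec (p e')) = ?l e' \<otimes> (sec (p e) \<otimes> sec (p e'))"
      using central[of "?l e'" "sec (p e)"] by (simp add: E.m_assoc[symmetric])
    then show ?thesis by (simp add: E.m_assoc)
  qed
  also have "\<dots> = ?l e \<otimes> ?l e' \<otimes> factor_set (p e) (p e') \<otimes> sec (p e \<otimes>\<^bsub>G\<^esub> p e')"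
    by (simp add: sec_mult E.m_assoc)
  finally show ?thesis
    by (simp add: fibre_coordinate_unique)
qed

lemma factor_set_one: "factor_set \<one>\<^bsub>G\<^esub> \<one>\<^bsub>G\<^esub> = sec \<one>\<^bsub>G\<^esub>"
  by (simp add: factor_set_def E.m_assoc)

lemma sec_one_kernel [simp]: "sec \<one>\<^bsub>G\<^esub> \<in> kernel E G p"
  by (intro kernelI) simp_all

lemma fibre_coordinate_kernel:
  "a \<in> kernel E G p \<Longrightarrow> fibre_coordinate a = a \<otimes> inv sec \<one>\<^bsub>G\<^esub>"
  by (simp add: fibre_coordinate_def)

text \<open>The commutator of two elements of \<open>E\<close> depends only on their images in \<open>G\<close>, so the chosen lifts of
  \<open>p e\<close> and \<open>p e'\<close> commute as well, and both products lie over the same element of \<open>G\<close>.\<close>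

lemma factor_set_commute:
  assumes [simp]: "e \<in> carrier E" "e' \<in> carrier E" and comm: "e \<otimes> e' = e' \<otimes> e"
  shows "factor_set (p e) (p e') = factor_set (p e') (p e)"
proof -
  let ?l = fibre_coordinate
  have "?l e \<otimes> ?l e' \<otimes> factor_set (p e) (p e') = ?l e \<otimes> ?l e' \<otimes> factor_set (p e') (p e)"
    using fibre_coordinate_mult[of e e'] fibre_coordinate_mult[of e' e] central[of "?l e" "?l e'"]
    by (simp add: comm)
  then show ?thesis
    by simp
qed

text \<open>The equivalence is \<open>e \<mapsto> (fibre_coordinate e \<cdot> \<eta>(p e), p e)\<close>: the correction by \<open>\<eta>\<close> turns the twist by
  \<open>factor_set\<close> into the twist by \<open>c\<close>.\<close>

lemma equivalent_cocycle_extension: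
  assumes c: "two_cocycle G K c"
    and \<eta> [simp]: "\<And>g. g \<in> carrier G \<Longrightarrow> \<eta> g \<in> kernel E G p"
    and eq: "\<And>g h. g \<in> carrier G \<Longrightarrow> h \<in> carrier G \<Longrightarrow>
      factor_set g h \<otimes> \<eta> (g \<otimes>\<^bsub>G\<^esub> h) = c g h \<otimes> (\<eta> g \<otimes> \<eta> h)"
  shows "equivalent_extensions K E (\<lambda>a. a) p (cocycle_extension G K c) (cocycle_incl G K c) snd"
proof -
  let ?F = "cocycle_extension G K c" and ?l = fibre_coordinate
  have [simp]: "c g h \<in> kernel E G p" if "g \<in> carrier G" "h \<in> carrier G" for g h
    using two_cocycleD(1)[OF c that] by simp
  define \<Theta> where "\<Theta> e = (?l e \<otimes> \<eta> (p e), p e)" for e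
  note m_ac = K.m_ac[simplified]
  have "\<Theta> \<in> hom E ?F"
  proof (rule homI)
    fix e e' assume [simp]: "e \<in> carrier E" "e' \<in> carrier E"
    have "?l (e \<otimes> e') \<otimes> \<eta> (p e \<otimes>\<^bsub>G\<^esub> p e') =
        ?l e \<otimes> ?l e' \<otimes> (factor_set (p e) (p e') \<otimes> \<eta> (p e \<otimes>\<^bsub>G\<^esub> p e'))"
      by (simp add: fibre_coordinate_mult E.m_assoc)
    also have "\<dots> = ?l e \<otimes> ?l e' \<otimes> (c (p e) (p e') \<otimes> (\<eta> (p e) \<otimes> \<eta> (p e')))"
      by (simp add: eq)
    also have "\<dots> = ?l e \<otimes> \<eta> (p e) \<otimes> (?l e' \<otimes> \<eta> (p e')) \<otimes> c (p e) (p e')"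
      by (simp add: m_ac)
    finally show "\<Theta> (e \<otimes> e') = \<Theta> e \<otimes>\<^bsub>?F\<^esub> \<Theta> e'"
      by (simp add: \<Theta>_def mult_cocycle_extension)
  qed (simp add: \<Theta>_def carrier_cocycle_extension)
  moreover have "bij_betw \<Theta> (carrier E) (carrier ?F)"
  proof (rule bij_betw_byWitness[where f' = "\<lambda>(a, g). a \<otimes> inv \<eta> g \<otimes> sec g"])
    show "\<forall>e\<in>carrier E. (\<lambda>(a, g). a \<otimes> inv \<eta> g \<otimes> sec g) (\<Theta> e) = e"
      by (simp add: \<Theta>_def E.m_assoc fibre_coordinate_sec E.inv_solve_left')
    show "\<forall>x\<in>carrier ?F. \<Theta> ((\<lambda>(a, g). a \<otimes> inv \<eta> g \<otimes> sec g) x) = x"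
    proof
      fix x assume "x \<in> carrier ?F"
      then obtain a g where x: "x = (a, g)" and [simp]: "a \<in> kernel E G p" "g \<in> carrier G"
        by (auto simp: carrier_cocycle_extension)
      show "\<Theta> ((\<lambda>(a, g). a \<otimes> inv \<eta> g \<otimes> sec g) x) = x"
        using fibre_coordinate_unique[of "a \<otimes> inv \<eta> g" g] by (simp add: x \<Theta>_def E.m_assoc)
    qed
    show "\<Theta> ` carrier E \<subseteq> carrier ?F"
      by (auto simp: \<Theta>_def carrier_cocycle_extension)
    show "(\<lambda>(a, g). a \<otimes> inv \<eta> g \<otimes> sec g) ` carrier ?F \<subseteq> carrier E"
      by (auto simp: carrier_cocycle_extension)
  qed
  ultimately have "\<Theta> \<in> iso E ?F"
    by (simp add: iso_def)
  moreover have "\<Theta> a = cocycle_incl G K c a" if a: "a \<in> carrier K" for a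
  proof -
    have [simp]: "a \<in> kernel E G p" "p a = \<one>\<^bsub>G\<^esub>"
      using a by simp_all
    \<comment> \<open>The hypothesis at \<open>(1, 1)\<close> accounts for the factor \<open>c(1, 1)\<^sup>-\<^sup>1\<close> in the inclusion of \<open>K\<close>.\<close>
    have "sec \<one>\<^bsub>G\<^esub> \<otimes> \<eta> \<one>\<^bsub>G\<^esub> = c \<one>\<^bsub>G\<^esub> \<one>\<^bsub>G\<^esub> \<otimes> \<eta> \<one>\<^bsub>G\<^esub> \<otimes> \<eta> \<one>\<^bsub>G\<^esub>"
      using eq[of "\<one>\<^bsub>G\<^esub>" "\<one>\<^bsub>G\<^esub>"] by (simp add: factor_set_one E.m_assoc)
    then have "sec \<one>\<^bsub>G\<^esub> = c \<one>\<^bsub>G\<^esub> \<one>\<^bsub>G\<^esub> \<otimes> \<eta> \<one>\<^bsub>G\<^esub>"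
      by (simp add: E.right_cancel)
    then have "sec \<one>\<^bsub>G\<^esub> = \<eta> \<one>\<^bsub>G\<^esub> \<otimes> c \<one>\<^bsub>G\<^esub> \<one>\<^bsub>G\<^esub>"
      using central[of "\<eta> \<one>\<^bsub>G\<^esub>" "c \<one>\<^bsub>G\<^esub> \<one>\<^bsub>G\<^esub>"] by simp
    then have "inv sec \<one>\<^bsub>G\<^esub> \<otimes> \<eta> \<one>\<^bsub>G\<^esub> = inv c \<one>\<^bsub>G\<^esub> \<one>\<^bsub>G\<^esub>"
      by (simp add: E.inv_mult_group E.m_assoc)
    then show ?thesis
      by (simp add: \<Theta>_def cocycle_incl_def inv_K fibre_coordinate_kernel E.m_assoc)
  qed
  ultimately show ?thesis
    unfolding equivalent_extensions_def by (auto simp: \<Theta>_def intro!: bexI[of _ \<Theta>])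
qed

lemma equivalent_extension_of_represented:
  assumes s: "splits_first_homology G s"
    and c: "represents G K (eval_cocycle K factor_set) c"
  shows "equivalent_extensions K E (\<lambda>a. a) p (cocycle_extension G K c) (cocycle_incl G K c) snd"
proof -
  have cc: "two_cocycle G K c"
    using c by (simp add: represents_def)
  have agree: "eval_on_chain K factor_set z = eval_on_chain K c z" if "z \<in> carrier (cycle_group 2 G)" for z
    using c that unfolding represents_def G.carrier_homology_2
    by (simp add: G.eval_cocycle_class[OF K.comm_group_axioms] two_cocycle_factor_set cc)
  obtain \<eta> where "\<And>g. g \<in> carrier G \<Longrightarrow> \<eta> g \<in> carrier K"
    and "\<And>g h. g \<in> carrier G \<Longrightarrow> h \<in> carrier G \<Longrightarrow>
      factor_set g h \<otimes>\<^bsub>K\<^esub> \<eta> (g \<otimes>\<^bsub>G\<^esub> h) = c g h \<otimes>\<^bsub>K\<^esub> (\<eta> g \<otimes>\<^bsub>K\<^esub> \<eta> h)"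
    using G.agreeing_on_cycles_imp_cohomologous[OF s K.comm_group_axioms
          two_cocycleD(1)[OF two_cocycle_factor_set] two_cocycleD(1)[OF cc] agree] by blast
  then show ?thesis
    using cc by (intro equivalent_cocycle_extension[of c \<eta>]) auto
qed

text \<open>Exactness of \<open>H\<^sub>2(G) \<rightarrow> K \<rightarrow> H\<^sub>1(E)\<close> at \<open>K\<close>.  Let \<open>I\<close> be the image of the evaluation map.  Modulo \<open>I\<close> the
  factor set is trivial on cycles, hence the coboundary of some \<open>\<eta>\<close>.  Then
  \<open>\<chi> e = fibre_coordinate e \<cdot> \<eta>(p e)\<close> is a homomorphism from \<open>E\<close> to the abelian group \<open>K / I\<close> that restricts
  to the projection on \<open>K\<close>.  It kills the derived subgroup, which contains \<open>K\<close>, so \<open>I = K\<close>.\<close>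

lemma eval_cocycle_surj:
  assumes s: "splits_first_homology G s" and stem: "kernel E G p \<subseteq> derived E (carrier E)"
  shows "eval_cocycle K factor_set ` carrier (homology 2 G) = carrier K"
proof -
  let ?e = "eval_cocycle K factor_set" and ?l = fibre_coordinate
  interpret e: group_hom "homology 2 G" K ?e
    using G.eval_cocycle_hom[OF K.comm_group_axioms two_cocycle_factor_set]
      G.comm_group_homology_2 K.is_group
    by (simp add: group_hom_def group_hom_axioms_def comm_group_def)
  define I where "I = ?e ` carrier (homology 2 G)"
  have I: "subgroup I K" unfolding I_def by (rule e.img_is_subgroup)
  interpret D: comm_group "K Mod I" using I by (rule K.abelian_FactGroup)
  interpret I: normal I K using I by (simp add: K.normal_iff_subgroup)
  let ?\<pi> = "\<lambda>a. I #>\<^bsub>K\<^esub> a"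
  have \<pi>: "?\<pi> \<in> hom K (K Mod I)" by (rule I.r_coset_hom_Mod)
  interpret \<pi>: group_hom K "K Mod I" ?\<pi>
    using \<pi> by unfold_locales
  have \<pi>_closed: "?\<pi> a \<in> carrier (K Mod I)" if "a \<in> kernel E G p" for a
    using that by (intro \<pi>.hom_closed) simp
  have agree: "eval_on_chain (K Mod I) (\<lambda>g h. ?\<pi> (factor_set g h)) z =
      eval_on_chain (K Mod I) (\<lambda>g h. \<one>\<^bsub>K Mod I\<^esub>) z" if z: "z \<in> carrier (cycle_group 2 G)" for z
  proof -
    have "eval_on_chain K factor_set z \<in> I"
      using z imageI[of "homology_class 2 G z" _ ?e]
      by (auto simp: I_def G.carrier_homology_2 G.eval_cocycle_class[OF K.comm_group_axioms two_cocycle_factor_set])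
    then have "?\<pi> (eval_on_chain K factor_set z) = I"
      by (rule I.rcos_const[OF K.is_group])
    moreover have "eval_on_chain (K Mod I) (\<lambda>g h. \<one>\<^bsub>K Mod I\<^esub>) z = \<one>\<^bsub>K Mod I\<^esub>"
      unfolding eval_on_chain_def by (rule D.finprod_one_eqI) (simp del: one_FactGroup)
    ultimately show ?thesis
      using eval_on_chain_comp_hom[OF K.comm_group_axioms D.comm_group_axioms \<pi>, of G factor_set z] z
      by (simp add: carrier_cycle_group)
  qed
  have \<pi>f: "?\<pi> (factor_set g h) \<in> carrier (K Mod I)" if "g \<in> carrier G" "h \<in> carrier G" for g h
    using that by (intro \<pi>_closed factor_set_closed)
  obtain \<eta> where \<eta>: "\<And>g. g \<in> carrier G \<Longrightarrow> \<eta> g \<in> carrier (K Mod I)"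
    and eq: "\<And>g h. g \<in> carrier G \<Longrightarrow> h \<in> carrier G \<Longrightarrow>
      ?\<pi> (factor_set g h) \<otimes>\<^bsub>K Mod I\<^esub> \<eta> (g \<otimes>\<^bsub>G\<^esub> h) =
      \<one>\<^bsub>K Mod I\<^esub> \<otimes>\<^bsub>K Mod I\<^esub> (\<eta> g \<otimes>\<^bsub>K Mod I\<^esub> \<eta> h)"
    using G.agreeing_on_cycles_imp_cohomologous[OF s D.comm_group_axioms \<pi>f D.one_closed agree] by blast
  define \<chi> where "\<chi> e = ?\<pi> (?l e) \<otimes>\<^bsub>K Mod I\<^esub> \<eta> (p e)" for e
  have \<chi>: "\<chi> \<in> hom E (K Mod I)"
  proof (rule homI)
    fix e assume "e \<in> carrier E"
    then show "\<chi> e \<in> carrier (K Mod I)"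
      unfolding \<chi>_def by (intro D.m_closed \<pi>.hom_closed \<eta>) simp_all
  next
    fix e e' assume ee [simp]: "e \<in> carrier E" "e' \<in> carrier E"
    have cl: "?\<pi> (?l e) \<in> carrier (K Mod I)" "?\<pi> (?l e') \<in> carrier (K Mod I)"
      "?\<pi> (factor_set (p e) (p e')) \<in> carrier (K Mod I)" "\<eta> (p e) \<in> carrier (K Mod I)"
      "\<eta> (p e') \<in> carrier (K Mod I)" "\<eta> (p e \<otimes>\<^bsub>G\<^esub> p e') \<in> carrier (K Mod I)"
      by (intro \<pi>_closed \<eta> fibre_coordinate_closed factor_set_closed p.hom_closed G.m_closed ee)+
    have "?\<pi> (?l (e \<otimes> e')) =
        ?\<pi> (?l e) \<otimes>\<^bsub>K Mod I\<^esub> ?\<pi> (?l e') \<otimes>\<^bsub>K Mod I\<^esub> ?\<pi> (factor_set (p e) (p e'))"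
      using \<pi>.hom_mult[of "?l e \<otimes> ?l e'" "factor_set (p e) (p e')"] \<pi>.hom_mult[of "?l e" "?l e'"]
      by (simp add: fibre_coordinate_mult)
    then have "\<chi> (e \<otimes> e') = ?\<pi> (?l e) \<otimes>\<^bsub>K Mod I\<^esub> ?\<pi> (?l e') \<otimes>\<^bsub>K Mod I\<^esub>
        (?\<pi> (factor_set (p e) (p e')) \<otimes>\<^bsub>K Mod I\<^esub> \<eta> (p e \<otimes>\<^bsub>G\<^esub> p e'))"
      unfolding \<chi>_def using cl by (simp add: D.m_assoc del: mult_FactGroup)
    also have "\<dots> = ?\<pi> (?l e) \<otimes>\<^bsub>K Mod I\<^esub> ?\<pi> (?l e') \<otimes>\<^bsub>K Mod I\<^esub>
        (\<eta> (p e) \<otimes>\<^bsub>K Mod I\<^esub> \<eta> (p e'))"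
      using eq[of "p e" "p e'"] cl by (simp del: mult_FactGroup one_FactGroup)
    also have "\<dots> = \<chi> e \<otimes>\<^bsub>K Mod I\<^esub> \<chi> e'"
      unfolding \<chi>_def using cl by (simp add: D.m_ac del: mult_FactGroup)
    finally show "\<chi> (e \<otimes> e') = \<chi> e \<otimes>\<^bsub>K Mod I\<^esub> \<chi> e'" .
  qed
  interpret \<chi>: group_hom E "K Mod I" \<chi>
    using \<chi> by unfold_locales
  have "\<chi> a = \<one>\<^bsub>K Mod I\<^esub>" if "a \<in> kernel E G p" for a
  proof -
    have "\<chi> ` derived E (carrier E) = derived (K Mod I) (\<chi> ` carrier E)"
      by (rule \<chi>.derived_img[symmetric]) simp
    also have "\<dots> = {\<one>\<^bsub>K Mod I\<^esub>}"
      using \<chi>.hom_closed by (intro D.derived_eq_singleton) auto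
    finally show ?thesis using that stem by blast
  qed
  moreover have "\<chi> a = ?\<pi> a" if [simp]: "a \<in> kernel E G p" for a
  proof -
    have cl: "?\<pi> (sec \<one>\<^bsub>G\<^esub>) \<in> carrier (K Mod I)" "\<eta> \<one>\<^bsub>G\<^esub> \<in> carrier (K Mod I)"
      "?\<pi> (a \<otimes> inv sec \<one>\<^bsub>G\<^esub>) \<in> carrier (K Mod I)"
      by (intro \<pi>_closed \<eta> sec_one_kernel mult_kernel inv_kernel that G.one_closed)+
    have "?\<pi> (sec \<one>\<^bsub>G\<^esub>) = \<eta> \<one>\<^bsub>G\<^esub>"
      using eq[of "\<one>\<^bsub>G\<^esub>" "\<one>\<^bsub>G\<^esub>"] cl by (simp add: factor_set_one D.right_cancel del: mult_FactGroup one_FactGroup)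
    then have "\<chi> a = ?\<pi> (a \<otimes> inv sec \<one>\<^bsub>G\<^esub>) \<otimes>\<^bsub>K Mod I\<^esub> ?\<pi> (sec \<one>\<^bsub>G\<^esub>)"
      by (simp add: \<chi>_def fibre_coordinate_kernel)
    also have "\<dots> = ?\<pi> (a \<otimes> inv sec \<one>\<^bsub>G\<^esub> \<otimes> sec \<one>\<^bsub>G\<^esub>)"
      using \<pi>.hom_mult[of "a \<otimes> inv sec \<one>\<^bsub>G\<^esub>" "sec \<one>\<^bsub>G\<^esub>"] by simp
    finally show ?thesis by (simp add: E.m_assoc)
  qed
  ultimately have "I #>\<^bsub>K\<^esub> a = I" if "a \<in> carrier K" for a
    using that by simp
  then have "carrier K \<subseteq> I"
    using K.coset_join1[OF _ _ I] subgroup.subset[OF I] by blast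
  then show ?thesis
    using subgroup.subset[OF I] by (auto simp: I_def)
qed

text \<open>A homomorphism over \<open>G\<close> into the extension of \<open>G\<close> by \<open>u\<close> restricts to \<open>\<nu> : K \<rightarrow> M\<close>, and the images of
  the lifts \<open>sec g\<close> show that \<open>\<nu> \<circ> factor_set\<close> and \<open>u\<close> differ by the coboundary of the
  \<open>M\<close>-components of these images.\<close>

lemma eval_cocycle_natural:
  assumes M: "comm_group M" and u: "two_cocycle G M u"
    and \<Phi>: "\<Phi> \<in> hom E (cocycle_extension G M u)"
    and over: "\<And>e. e \<in> carrier E \<Longrightarrow> snd (\<Phi> e) = p e"
  obtains \<nu> where "\<nu> \<in> hom K M"
    and "\<And>z. z \<in> carrier (cycle_group 2 G) \<Longrightarrow>
      \<nu> (eval_on_chain K factor_set z) = eval_on_chain M u z"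
proof -
  interpret M: comm_group M by fact
  define m where "m e = fst (\<Phi> e)" for e
  have m [simp]: "m e \<in> carrier M" if "e \<in> carrier E" for e
    using hom_in_carrier[OF \<Phi> that] by (auto simp: m_def carrier_cocycle_extension)
  note [simp] = two_cocycleD(1)[OF u]
  have \<Phi>_eq: "\<Phi> e = (m e, p e)" if "e \<in> carrier E" for e
    using over[OF that] by (simp add: m_def prod_eq_iff)
  have m_mult: "m (e \<otimes> e') = m e \<otimes>\<^bsub>M\<^esub> m e' \<otimes>\<^bsub>M\<^esub> u (p e) (p e')"
    if "e \<in> carrier E" "e' \<in> carrier E" for e e'
    using hom_mult[OF \<Phi> that] that by (simp add: \<Phi>_eq mult_cocycle_extension)
  \<comment> \<open>\<open>M\<close> is included in the extension by \<open>b \<mapsto> (b \<cdot> u(1, 1)\<^sup>-\<^sup>1, 1)\<close>, which is inverted here.\<close>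
  define \<nu> where "\<nu> a = m a \<otimes>\<^bsub>M\<^esub> u \<one>\<^bsub>G\<^esub> \<one>\<^bsub>G\<^esub>" for a
  have \<nu>_mult: "m (a \<otimes> e) = \<nu> a \<otimes>\<^bsub>M\<^esub> m e" if "a \<in> kernel E G p" "e \<in> carrier E" for a e
    using that two_cocycle_one(1)[OF G.is_group M u, of "p e"]
    by (simp add: \<nu>_def m_mult M.m_ac)
  have \<nu>: "\<nu> \<in> hom K M"
  proof (rule homI)
    fix a b assume "a \<in> carrier K" "b \<in> carrier K"
    then show "\<nu> (a \<otimes>\<^bsub>K\<^esub> b) = \<nu> a \<otimes>\<^bsub>M\<^esub> \<nu> b"
      using \<nu>_mult[of a b] by (simp add: \<nu>_def[of "a \<otimes> b"]) (simp add: \<nu>_def M.m_assoc)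
  qed (simp add: \<nu>_def)
  have eq: "\<nu> (factor_set g h) \<otimes>\<^bsub>M\<^esub> m (sec (g \<otimes>\<^bsub>G\<^esub> h)) = u g h \<otimes>\<^bsub>M\<^esub> (m (sec g) \<otimes>\<^bsub>M\<^esub> m (sec h))"
    if "g \<in> carrier G" "h \<in> carrier G" for g h
    using that \<nu>_mult[of "factor_set g h" "sec (g \<otimes>\<^bsub>G\<^esub> h)"] m_mult[of "sec g" "sec h"]
    by (simp add: sec_mult M.m_comm)
  show thesis
  proof
    show "\<nu> \<in> hom K M" by (rule \<nu>)
    fix z assume z: "z \<in> carrier (cycle_group 2 G)"
    have "\<nu> (eval_on_chain K factor_set z) = eval_on_chain M (\<lambda>g h. \<nu> (factor_set g h)) z"
      using z by (intro eval_on_chain_comp_hom[OF K.comm_group_axioms M \<nu>])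
        (auto simp: carrier_cycle_group)
    also have "\<dots> = eval_on_chain M u z"
      using hom_in_carrier[OF \<nu>]
      by (intro G.eval_on_chain_cohomologous[OF M _ _ _ eq z]) auto
    finally show "\<nu> (eval_on_chain K factor_set z) = eval_on_chain M u z" .
  qed
qed

text \<open>The evaluation map itself serves as \<open>\<phi>\<close>, and \<open>\<theta>\<close> is the isomorphism that it induces on the quotient
  by its kernel.\<close>

lemma stem_extension_homology:
  assumes s: "splits_first_homology G s" and stem: "kernel E G p \<subseteq> derived E (carrier E)"
    and N: "N = kernel (homology 2 G) K (eval_cocycle K factor_set)"
  shows "\<exists>\<theta> \<in> iso (homology 2 G Mod N) K. \<exists>\<phi> \<in> hom (homology 2 G) K.
    (\<forall>U \<in> carrier (homology 2 G). \<phi> U = \<theta> (N #>\<^bsub>homology 2 G\<^esub> U)) \<and>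
    (\<exists>c. represents G K \<phi> c) \<and>
    (\<forall>c. represents G K \<phi> c \<longrightarrow>
      equivalent_extensions K E (\<lambda>a. a) p (cocycle_extension G K c) (cocycle_incl G K c) snd)"
proof -
  let ?\<phi> = "eval_cocycle K factor_set"
  let ?\<theta> = "\<lambda>V. the_elem (?\<phi> ` V)"
  have \<phi>: "?\<phi> \<in> hom (homology 2 G) K"
    by (rule G.eval_cocycle_hom[OF K.comm_group_axioms two_cocycle_factor_set])
  interpret H: comm_group "homology 2 G" by (rule G.comm_group_homology_2)
  interpret \<phi>: group_hom "homology 2 G" K ?\<phi>
    using \<phi> by unfold_locales
  have N_kernel: "subgroup N (homology 2 G)"
    unfolding N by (rule \<phi>.subgroup_kernel)
  have \<theta>: "?\<theta> \<in> iso (homology 2 G Mod N) K"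
    unfolding N by (rule \<phi>.FactGroup_iso_set) (rule eval_cocycle_surj[OF s stem])
  have "?\<phi> U = ?\<theta> (N #>\<^bsub>homology 2 G\<^esub> U)" if U: "U \<in> carrier (homology 2 G)" for U
  proof (rule the_elem_image_constant[symmetric])
    show "U \<in> N #>\<^bsub>homology 2 G\<^esub> U"
      using U N_kernel by (rule H.rcos_self)
    fix V assume "V \<in> N #>\<^bsub>homology 2 G\<^esub> U"
    then obtain W where "W \<in> carrier (homology 2 G)" "?\<phi> W = \<one>\<^bsub>K\<^esub>" "V = W \<otimes>\<^bsub>homology 2 G\<^esub> U"
      by (auto simp: r_coset_def N kernel_def[of "homology 2 G"])
    then show "?\<phi> V = ?\<phi> U"
      using \<phi>.hom_mult[of W U] \<phi>.hom_closed[OF U] U K.l_one[of "?\<phi> U"] by simp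
  qed
  then have "\<forall>U \<in> carrier (homology 2 G). ?\<phi> U = ?\<theta> (N #>\<^bsub>homology 2 G\<^esub> U)"
    by blast
  moreover have "represents G K ?\<phi> factor_set"
    by (simp add: represents_def two_cocycle_factor_set)
  ultimately show ?thesis
    by (intro bexI[OF _ \<theta>] bexI[OF _ \<phi>] conjI exI[of _ factor_set] allI impI
        equivalent_extension_of_represented[OF s])
qed

end

subsection \<open>The universal cocycle\<close>

text \<open>Sending \<open>(g, h)\<close> to the symbol \<open>[g|h]\<close> is a cocycle as soon as boundaries are set to zero, and
  evaluating it on a chain returns the class of that chain.  With it one obtains central extensions
  that detect homology classes without extending homomorphisms from cycles to chains.\<close>

lemma (in group) universal_cocycle:
  assumes B: "subgroup B (bar_chain_group 2 G)" and sub: "boundaries 2 G \<subseteq> B"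
  defines "M \<equiv> bar_chain_group 2 G Mod B"
    and "u \<equiv> \<lambda>g h. B #>\<^bsub>bar_chain_group 2 G\<^esub> frag_of [g, h]"
  shows "comm_group M" and "two_cocycle G M u"
    and "z \<in> carrier (bar_chain_group 2 G) \<Longrightarrow> eval_on_chain M u z = B #>\<^bsub>bar_chain_group 2 G\<^esub> z"
proof -
  interpret C: comm_group "bar_chain_group 2 G" by (rule comm_group_bar_chain_group)
  show M: "comm_group M" unfolding M_def using B by (rule C.abelian_FactGroup)
  interpret B: normal B "bar_chain_group 2 G" using B by (simp add: C.normal_iff_subgroup)
  let ?q = "\<lambda>z. B #>\<^bsub>bar_chain_group 2 G\<^esub> z"
  have q: "?q \<in> hom (bar_chain_group 2 G) M"
    unfolding M_def by (rule B.r_coset_hom_Mod)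
  have u: "u g h \<in> carrier M" if "g \<in> carrier G" "h \<in> carrier G" for g h
    unfolding u_def using that by (intro hom_in_carrier[OF q]) (simp add: frag_of_2_chain)
  show "two_cocycle G M u"
    unfolding two_cocycle_def
  proof (intro conjI ballI u)
    fix g h k assume ghk: "g \<in> carrier G" "h \<in> carrier G" "k \<in> carrier G"
    let ?x = "frag_of [g, h] + frag_of [g \<otimes> h, k]" and ?y = "frag_of [h, k] + frag_of [g, h \<otimes> k]"
    have xy: "?x \<in> carrier (bar_chain_group 2 G)" "?y \<in> carrier (bar_chain_group 2 G)"
      using ghk by (simp_all add: frag_of_2_chain bar_chain_group_closed)
    have "?y - ?x = bar_boundary G (frag_of [g, h, k])"
      by (simp add: bar_boundary_3)
    also have "\<dots> \<in> boundaries 2 G"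
      unfolding boundaries_def by (rule imageI) (simp add: frag_of_3_chain ghk)
    finally have "?y - ?x \<in> B"
      using sub by blast
    moreover have "?y \<otimes>\<^bsub>bar_chain_group 2 G\<^esub> inv\<^bsub>bar_chain_group 2 G\<^esub> ?x = ?y - ?x"
      using xy by (simp add: mult_bar_chain_group inv_bar_chain_group)
    ultimately have "?y \<in> ?q ?x"
      using B.rcos_module[OF C.is_group xy] by simp
    then have "?q ?x = ?q ?y"
      using xy(1) B by (rule C.repr_independence)
    then show "u g h \<otimes>\<^bsub>M\<^esub> u (g \<otimes> h) k = u h k \<otimes>\<^bsub>M\<^esub> u g (h \<otimes> k)"
      using hom_mult[OF q, of "frag_of [g, h]" "frag_of [g \<otimes> h, k]"]
        hom_mult[OF q, of "frag_of [h, k]" "frag_of [g, h \<otimes> k]"] ghk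
      by (simp add: u_def frag_of_2_chain mult_bar_chain_group)
  qed
  show "eval_on_chain M u z = ?q z" if "z \<in> carrier (bar_chain_group 2 G)"
  proof (rule hom_2_chains_eqI[OF comm_group.axioms(2)[OF M] eval_on_chain_hom[OF M u] q _ that])
    fix g h assume "g \<in> carrier G" "h \<in> carrier G"
    then have "eval_on_chain M u (frag_of [g, h]) = u g h"
      using M u by (intro eval_on_chain_frag_of)
    then show "eval_on_chain M u (frag_of [g, h]) = ?q (frag_of [g, h])"
      by (simp add: u_def)
  qed
qed


section \<open>The groups attached to a rack\<close>

lemma group_opposite_group:
  assumes "group G"
  shows "group (opposite_group G)"
proof -
  interpret group G by fact
  show ?thesis
    by (rule groupI) (auto simp: opposite_group_def m_assoc intro: bexI[of _ "inv\<^bsub>G\<^esub> _"])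
qed

context rack
begin

text \<open>Here \<open>s x\<close> is right translation by \<open>x\<close>, \<open>I = Inn(X)\<close>, and \<open>orb x\<close> is
  the orbit of \<open>x\<close>.  Elements of \<open>I\<close> act from the right, so the product \<open>f g\<close> is \<open>f\<close> followed by \<open>g\<close>.\<close>

abbreviation s where "s \<equiv> rack_symmetry X (\<triangleright>)"
abbreviation I where "I \<equiv> Inn X (\<triangleright>)"
abbreviation E where "E \<equiv> As X (\<triangleright>)"
abbreviation e where "e \<equiv> As_gen X (\<triangleright>)"
abbreviation G where "G \<equiv> Inn_bar X (\<triangleright>)"
abbreviation p where "p \<equiv> alpha_psi X (\<triangleright>)"
abbreviation \<psi> where "\<psi> \<equiv> As_psi X (\<triangleright>)"
abbreviation \<alpha> where "\<alpha> \<equiv> As_alpha X (\<triangleright>)"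
abbreviation orb where "orb \<equiv> rack_orbit X (\<triangleright>)"

lemma rop_closed [simp]: "x \<in> X \<Longrightarrow> y \<in> X \<Longrightarrow> x \<triangleright> y \<in> X"
  using bij[of y] by (auto simp: bij_betw_def)

lemma s_apply [simp]: "x \<in> X \<Longrightarrow> s y x = x \<triangleright> y"
  by (simp add: rack_symmetry_def)

lemma s_Bij: "x \<in> X \<Longrightarrow> s x \<in> Bij X"
  using bij[of x] by (simp add: Bij_def rack_symmetry_def)

subsection \<open>The inner automorphism group\<close>

sublocale opp: group "opposite_group (BijGroup X)"
  by (rule group_opposite_group[OF group_BijGroup])

sublocale I: group I
  unfolding Inn_def by (rule opp.group_subgroup_generated)

lemma carrier_Inn_subset: "carrier I \<subseteq> Bij X"
  using opp.carrier_subgroup_generated_subset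
  by (auto simp: Inn_def opposite_group_def BijGroup_def)

lemma s_in_Inn [simp]: "x \<in> X \<Longrightarrow> s x \<in> carrier I"
  using s_Bij
  by (auto simp: Inn_def carrier_subgroup_generated opposite_group_def BijGroup_def intro!: generate.incl)

lemma mult_Inn: "f \<in> carrier I \<Longrightarrow> g \<in> carrier I \<Longrightarrow> f \<otimes>\<^bsub>I\<^esub> g = compose X g f"
  using carrier_Inn_subset by (auto simp: Inn_def opposite_group_def BijGroup_def subset_iff)

lemma one_Inn: "\<one>\<^bsub>I\<^esub> = (\<lambda>x\<in>X. x)"
  by (simp add: Inn_def opposite_group_def BijGroup_def)

lemma Inn_apply_closed [simp]: "f \<in> carrier I \<Longrightarrow> x \<in> X \<Longrightarrow> f x \<in> X"
  using carrier_Inn_subset Bij_imp_funcset by blast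

lemma Inn_mult_apply [simp]:
  "f \<in> carrier I \<Longrightarrow> g \<in> carrier I \<Longrightarrow> x \<in> X \<Longrightarrow> (f \<otimes>\<^bsub>I\<^esub> g) x = g (f x)"
  by (simp add: mult_Inn compose_def)

lemma Inn_one_apply [simp]: "x \<in> X \<Longrightarrow> \<one>\<^bsub>I\<^esub> x = x"
  by (simp add: one_Inn)

lemma Inn_eqI:
  assumes "f \<in> carrier I" and "g \<in> carrier I" and "\<And>x. x \<in> X \<Longrightarrow> f x = g x"
  shows "f = g"
  using assms carrier_Inn_subset by (intro extensionalityI[of f X g]) (auto dest: Bij_imp_extensional)

lemma s_relation:
  assumes "x \<in> X" and "y \<in> X"
  shows "s x \<otimes>\<^bsub>I\<^esub> s y = s y \<otimes>\<^bsub>I\<^esub> s (x \<triangleright> y)"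
proof (rule Inn_eqI)
  fix a assume "a \<in> X"
  then show "(s x \<otimes>\<^bsub>I\<^esub> s y) a = (s y \<otimes>\<^bsub>I\<^esub> s (x \<triangleright> y)) a"
    using assms self_distrib[of a x y] by simp
qed (use assms in auto)

lemma orb_invariant:
  assumes f: "f \<in> carrier I" and x: "x \<in> X"
  shows "orb (f x) = orb x"
proof -
  have "(f \<otimes>\<^bsub>I\<^esub> g) x \<in> orb x" if "g \<in> carrier I" for g
    using I.m_closed[OF f that] unfolding rack_orbit_def orbit_def by blast
  then have "g (f x) \<in> orb x" if "g \<in> carrier I" for g
    using that f x by simp
  moreover have "g x \<in> orb (f x)" if g: "g \<in> carrier I" for g
  proof -
    have "(inv\<^bsub>I\<^esub> f) (f x) = (f \<otimes>\<^bsub>I\<^esub> inv\<^bsub>I\<^esub> f) x"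
      using f x by (subst Inn_mult_apply) simp_all
    then have "(inv\<^bsub>I\<^esub> f \<otimes>\<^bsub>I\<^esub> g) (f x) = g x"
      using f g x by simp
    moreover have "(inv\<^bsub>I\<^esub> f \<otimes>\<^bsub>I\<^esub> g) (f x) \<in> orb (f x)"
      using I.m_closed[OF I.inv_closed[OF f] g] unfolding rack_orbit_def orbit_def by blast
    ultimately show ?thesis by simp
  qed
  ultimately show ?thesis
    unfolding rack_orbit_def orbit_def by blast
qed

lemma orb_in_orbits: "x \<in> X \<Longrightarrow> orb x \<in> rack_orbits X (\<triangleright>)"
  by (auto simp: rack_orbits_def orbits_def rack_orbit_def)

lemma orb_self: "x \<in> X \<Longrightarrow> x \<in> orb x"
  unfolding rack_orbit_def orbit_def by (auto intro!: exI[of _ "\<one>\<^bsub>I\<^esub>"])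

definition rep where "rep \<omega> = (SOME y. y \<in> \<omega>)"

lemma rep:
  assumes "x \<in> X"
  obtains f where "f \<in> carrier I" and "f x = rep (orb x)"
  using someI[of "\<lambda>y. y \<in> orb x", OF orb_self[OF assms]]
  by (auto simp: rep_def rack_orbit_def orbit_def)

lemma rep_in [simp]: "x \<in> X \<Longrightarrow> rep (orb x) \<in> X"
  by (metis rep Inn_apply_closed)

subsection \<open>The associated group\<close>

sublocale E: group E
  unfolding As_def by (rule group_presented_group)

lemma e_closed [simp]: "x \<in> X \<Longrightarrow> e x \<in> carrier E"
  by (auto simp: As_gen_def As_def carrier_presented_group)

lemma carrier_As: "carrier E = generate E (e ` X)"
  unfolding As_def As_gen_def by (rule carrier_presented_group_generate)

lemma As_relation:
  assumes "x \<in> X" and "y \<in> X"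
  shows "e x \<otimes>\<^bsub>E\<^esub> e y = e y \<otimes>\<^bsub>E\<^esub> e (x \<triangleright> y)"
proof -
  have "([(x, True), (y, True)], [(y, True), (x \<triangleright> y, True)]) \<in> As_relations X (\<triangleright>)"
    using assms by (auto simp: As_relations_def)
  then have "pres_eq X (As_relations X (\<triangleright>)) ([] @ [(x, True), (y, True)] @ []) ([] @ [(y, True), (x \<triangleright> y, True)] @ [])"
    using assms by (intro pres_eq.relation) auto
  then show ?thesis
    using assms by (simp add: As_gen_def As_def mult_pres_class pres_class_eq_iff)
qed

lemma As_lift:
  assumes "group H" and f: "\<And>x. x \<in> X \<Longrightarrow> f x \<in> carrier H"
    and rel: "\<And>x y. x \<in> X \<Longrightarrow> y \<in> X \<Longrightarrow> f x \<otimes>\<^bsub>H\<^esub> f y = f y \<otimes>\<^bsub>H\<^esub> f (x \<triangleright> y)"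
  shows "pres_lift H f \<in> hom E H" and "x \<in> X \<Longrightarrow> pres_lift H f (e x) = f x"
proof -
  interpret H: group H by fact
  have fX: "f \<in> X \<rightarrow> carrier H" using f by blast
  have R: "eval_word H f r = eval_word H f t" if "(r, t) \<in> As_relations X (\<triangleright>)" for r t
  proof -
    obtain x y where xy: "x \<in> X" "y \<in> X"
      and rt: "r = [(x, True), (y, True)]" "t = [(y, True), (x \<triangleright> y, True)]"
      using \<open>(r, t) \<in> As_relations X (\<triangleright>)\<close> by (auto simp: As_relations_def)
    show ?thesis
      using rel[OF xy] xy by (simp add: rt eval_word_def f)
  qed
  show "pres_lift H f \<in> hom E H"
    unfolding As_def by (rule H.pres_lift_hom[OF fX R])
  show "pres_lift H f (e x) = f x" if "x \<in> X"
    unfolding As_gen_def by (rule H.pres_lift_generator[OF fX R that])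
qed

lemma As_hom_eqI:
  assumes H: "group H" and f: "f \<in> hom E H" and g: "g \<in> hom E H"
    and eq: "\<And>x. x \<in> X \<Longrightarrow> f (e x) = g (e x)" and u: "u \<in> carrier E"
  shows "f u = g u"
proof -
  interpret f: group_hom E H f
    using H f by (simp add: group_hom_def group_hom_axioms_def E.is_group)
  interpret g: group_hom E H g
    using H g by (simp add: group_hom_def group_hom_axioms_def E.is_group)
  have "u \<in> carrier E \<and> f u = g u"
    using u[unfolded carrier_As]
  proof induction
    case one
    then show ?case using f.hom_one g.hom_one by simp
  next
    case (incl h)
    then show ?case using eq by auto
  next
    case (inv h)
    then show ?case using eq f.hom_inv g.hom_inv by auto
  next
    case (eng h1 h2)
    then show ?case using f.hom_mult g.hom_mult by simp
  qed
  then show ?thesis ..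
qed

lemma psi_hom: "\<psi> \<in> hom E I" and psi_gen [simp]: "x \<in> X \<Longrightarrow> \<psi> (e x) = s x"
  unfolding As_psi_def by (rule As_lift[OF I.is_group s_in_Inn s_relation]; assumption)+

lemma alpha_hom: "\<alpha> \<in> hom E (free_Abelian_group (rack_orbits X (\<triangleright>)))"
  and alpha_gen [simp]: "x \<in> X \<Longrightarrow> \<alpha> (e x) = frag_of (orb x)"
proof -
  have "orb (x \<triangleright> y) = orb x" if "x \<in> X" "y \<in> X" for x y
    using orb_invariant[OF s_in_Inn[OF that(2)] that(1)] that by simp
  note * = As_lift[OF group_free_Abelian_group[of "rack_orbits X (\<triangleright>)"], of "\<lambda>x. frag_of (orb x)", folded As_alpha_def]
  show "\<alpha> \<in> hom E (free_Abelian_group (rack_orbits X (\<triangleright>)))"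
    by (rule *) (auto simp: orb_in_orbits \<open>\<And>x y. _ \<Longrightarrow> _ \<Longrightarrow> orb (x \<triangleright> y) = orb x\<close>)
  show "\<alpha> (e x) = frag_of (orb x)" if "x \<in> X"
    by (rule *) (auto simp: orb_in_orbits that \<open>\<And>x y. _ \<Longrightarrow> _ \<Longrightarrow> orb (x \<triangleright> y) = orb x\<close>)
qed

sublocale \<psi>: group_hom E I \<psi>
  using psi_hom by unfold_locales

sublocale \<alpha>: group_hom E "free_Abelian_group (rack_orbits X (\<triangleright>))" \<alpha>
  using alpha_hom by (simp add: group_hom_def group_hom_axioms_def E.is_group)

lemma psi_surj: "\<psi> ` carrier E = carrier I"
proof
  have "subgroup (\<psi> ` carrier E) I"
    by (rule \<psi>.img_is_subgroup)
  then have "subgroup (\<psi> ` carrier E) (opposite_group (BijGroup X))"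
    unfolding Inn_def by (simp add: opp.subgroup_subgroup_generated_iff)
  moreover have "s x \<in> \<psi> ` carrier E" if "x \<in> X" for x
    using psi_gen[OF that] e_closed[OF that] by (metis image_eqI)
  ultimately show "carrier I \<subseteq> \<psi> ` carrier E"
    unfolding Inn_def carrier_subgroup_generated
    by (intro opp.generate_subgroup_incl) auto
qed auto

text \<open>The defining relations are the case of a generator \<open>u\<close>.  The identity passes to inverses, with \<open>x\<close>
  replaced by its preimage under \<open>\<psi>(u)\<close>, and to products, because \<open>\<psi>\<close> acts from the right.\<close>

lemma conjugate_generator:
  assumes "u \<in> carrier E" and "x \<in> X"
  shows "e x \<otimes>\<^bsub>E\<^esub> u = u \<otimes>\<^bsub>E\<^esub> e (\<psi> u x)"
proof -
  have "u \<in> carrier E \<and> (\<forall>x\<in>X. e x \<otimes>\<^bsub>E\<^esub> u = u \<otimes>\<^bsub>E\<^esub> e (\<psi> u x))"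
    using assms(1)[unfolded carrier_As]
  proof induction
    case one
    then show ?case using \<psi>.hom_one by simp
  next
    case (incl h)
    then obtain y where y: "y \<in> X" "h = e y" by blast
    then show ?case using As_relation[of _ y] by simp
  next
    case (inv h)
    then obtain y where y: "y \<in> X" "h = e y" by blast
    have "e x \<otimes>\<^bsub>E\<^esub> inv\<^bsub>E\<^esub> h = inv\<^bsub>E\<^esub> h \<otimes>\<^bsub>E\<^esub> e (\<psi> (inv\<^bsub>E\<^esub> h) x)" if x: "x \<in> X" for x
    proof -
      let ?x = "\<psi> (inv\<^bsub>E\<^esub> h) x"
      have x': "?x \<in> X" using x y by simp
      have "s y ?x = (\<psi> (inv\<^bsub>E\<^esub> h) \<otimes>\<^bsub>I\<^esub> s y) x"
        using x y by (subst Inn_mult_apply) auto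
      also have "\<dots> = x"
        using x y by (simp add: I.l_inv)
      finally have "?x \<triangleright> y = x" using x' by simp
      then have "e ?x \<otimes>\<^bsub>E\<^esub> h = h \<otimes>\<^bsub>E\<^esub> e x"
        using As_relation[OF x' y(1)] y by simp
      then have "inv\<^bsub>E\<^esub> h \<otimes>\<^bsub>E\<^esub> (e ?x \<otimes>\<^bsub>E\<^esub> h) \<otimes>\<^bsub>E\<^esub> inv\<^bsub>E\<^esub> h = inv\<^bsub>E\<^esub> h \<otimes>\<^bsub>E\<^esub> (h \<otimes>\<^bsub>E\<^esub> e x) \<otimes>\<^bsub>E\<^esub> inv\<^bsub>E\<^esub> h"
        by simp
      then show ?thesis
        using x x' y by (simp add: E.m_assoc E.inv_solve_left' E.inv_solve_left)
    qed
    then show ?case using y by simp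
  next
    case (eng u v)
    then have uv: "u \<in> carrier E" "v \<in> carrier E" by auto
    have "e x \<otimes>\<^bsub>E\<^esub> (u \<otimes>\<^bsub>E\<^esub> v) = u \<otimes>\<^bsub>E\<^esub> v \<otimes>\<^bsub>E\<^esub> e (\<psi> (u \<otimes>\<^bsub>E\<^esub> v) x)" if "x \<in> X" for x
    proof -
      have ux: "\<psi> u x \<in> X" using uv that by simp
      have "e x \<otimes>\<^bsub>E\<^esub> (u \<otimes>\<^bsub>E\<^esub> v) = e x \<otimes>\<^bsub>E\<^esub> u \<otimes>\<^bsub>E\<^esub> v"
        using that uv by (simp add: E.m_assoc)
      also have "\<dots> = u \<otimes>\<^bsub>E\<^esub> e (\<psi> u x) \<otimes>\<^bsub>E\<^esub> v"
        using eng that by simp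
      also have "\<dots> = u \<otimes>\<^bsub>E\<^esub> (e (\<psi> u x) \<otimes>\<^bsub>E\<^esub> v)"
        using uv ux by (simp add: E.m_assoc)
      also have "\<dots> = u \<otimes>\<^bsub>E\<^esub> (v \<otimes>\<^bsub>E\<^esub> e (\<psi> v (\<psi> u x)))"
        using eng ux by simp
      also have "\<dots> = u \<otimes>\<^bsub>E\<^esub> v \<otimes>\<^bsub>E\<^esub> e (\<psi> (u \<otimes>\<^bsub>E\<^esub> v) x)"
        using uv ux that by (simp add: E.m_assoc \<psi>.hom_mult)
      finally show ?thesis .
    qed
    then show ?case using uv by simp
  qed
  then show ?thesis using assms(2) by blast
qed

lemma carrier_Inn_bar: "carrier G = p ` carrier E"
  by (simp add: Inn_bar_def)

lemma mult_Inn_bar: "g \<otimes>\<^bsub>G\<^esub> h = (fst g + fst h, snd g \<otimes>\<^bsub>I\<^esub> snd h)"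
  by (cases g; cases h) (simp add: Inn_bar_def alpha_psi_target_def)

lemma p_target_hom: "p \<in> hom E (alpha_psi_target X (\<triangleright>))"
  unfolding alpha_psi_target_def
  using \<alpha>.hom_closed
  by (intro homI) (auto simp: alpha_psi_def \<alpha>.hom_mult \<psi>.hom_mult subset_iff)

lemma snd_p [simp]: "snd (p u) = \<psi> u"
  by (simp add: alpha_psi_def)

lemma fst_p [simp]: "fst (p u) = \<alpha> u"
  by (simp add: alpha_psi_def)

lemma group_target: "group (alpha_psi_target X (\<triangleright>))"
  unfolding alpha_psi_target_def by (intro DirProd_group I.is_group group_free_Abelian_group)

sublocale G: group G
proof -
  interpret T: group "alpha_psi_target X (\<triangleright>)" by (rule group_target)
  interpret t: group_hom E "alpha_psi_target X (\<triangleright>)" p using p_target_hom by unfold_locales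
  show "group G"
    unfolding Inn_bar_def by (intro T.subgroup_imp_group t.img_is_subgroup)
qed

lemma kernel_eq: "kernel E (alpha_psi_target X (\<triangleright>)) p = kernel E G p"
  by (simp add: kernel_def Inn_bar_def)

lemma kernel_alpha_psi:
  assumes "a \<in> kernel E G p"
  shows "a \<in> carrier E" and "\<alpha> a = 0" and "\<psi> a = \<one>\<^bsub>I\<^esub>"
  using assms by (auto simp: kernel_def Inn_bar_def alpha_psi_target_def alpha_psi_def)

text \<open>An element \<open>a\<close> of the kernel acts trivially on \<open>X\<close>, so it commutes with each \<open>e x\<close>.\<close>

lemma kernel_central:
  assumes a: "a \<in> kernel E G p" and u: "u \<in> carrier E"
  shows "a \<otimes>\<^bsub>E\<^esub> u = u \<otimes>\<^bsub>E\<^esub> a"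
proof -
  note [simp] = kernel_alpha_psi[OF a]
  have "u \<in> carrier E \<and> a \<otimes>\<^bsub>E\<^esub> u = u \<otimes>\<^bsub>E\<^esub> a"
    using u[unfolded carrier_As]
  proof induction
    case (incl h)
    then show ?case using conjugate_generator[of a] by auto
  next
    case (inv h)
    then have h: "h \<in> carrier E" "a \<otimes>\<^bsub>E\<^esub> h = h \<otimes>\<^bsub>E\<^esub> a"
      using conjugate_generator[of a] by auto
    then have "h \<otimes>\<^bsub>E\<^esub> (a \<otimes>\<^bsub>E\<^esub> inv\<^bsub>E\<^esub> h) = h \<otimes>\<^bsub>E\<^esub> a \<otimes>\<^bsub>E\<^esub> inv\<^bsub>E\<^esub> h"
      by (simp add: E.m_assoc)
    also have "\<dots> = a \<otimes>\<^bsub>E\<^esub> h \<otimes>\<^bsub>E\<^esub> inv\<^bsub>E\<^esub> h"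
      by (simp only: h(2))
    also have "\<dots> = a"
      using h(1) by (simp add: E.m_assoc)
    finally show ?case
      using h(1) by (simp add: E.inv_solve_left)
  next
    case (eng u v)
    then have "a \<otimes>\<^bsub>E\<^esub> (u \<otimes>\<^bsub>E\<^esub> v) = u \<otimes>\<^bsub>E\<^esub> v \<otimes>\<^bsub>E\<^esub> a"
      by (metis E.m_assoc kernel_alpha_psi(1)[OF a])
    then show ?case using eng by simp
  qed simp
  then show ?thesis ..
qed

sublocale central_quotient E G p
proof unfold_locales
  show "p \<in> hom E G"
    using p_target_hom by (auto simp: hom_def Inn_bar_def)
qed (rule carrier_Inn_bar[symmetric], rule kernel_central)

lemma As_kernel_eq: "As_kernel X (\<triangleright>) = K"
  by (simp add: As_kernel_def kernel_eq)

end


section \<open>The kernel of the associated group\<close>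

lemma (in group) mult_mod_boundaries:
  assumes "g \<in> carrier G" and "h \<in> carrier G"
  shows "frag_of [g] + frag_of [h] - frag_of [g \<otimes> h] \<in> boundaries 1 G"
proof -
  have "frag_of [g] + frag_of [h] - frag_of [g \<otimes> h] = bar_boundary G (frag_of [g, h])"
    by (simp add: bar_boundary_2)
  moreover have "frag_of [g, h] \<in> carrier (bar_chain_group (Suc 1) G)"
    using assms frag_of_2_chain[of g h G] by (simp add: numeral_2_eq_2)
  ultimately show ?thesis
    unfolding boundaries_def by blast
qed

context rack
begin

lemma p_e_commute:
  assumes "u \<in> carrier E" and "x \<in> X"
  shows "p (e x) \<otimes>\<^bsub>G\<^esub> p u = p u \<otimes>\<^bsub>G\<^esub> p (e (\<psi> u x))"
  using assms conjugate_generator[OF assms] p.hom_mult[of "e x" u] p.hom_mult[of u "e (\<psi> u x)"]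
  by simp

text \<open>Subtract the boundaries of \<open>[p (e x)|p u]\<close> and \<open>[p u|p (e y)]\<close>, where \<open>y = \<psi> u x\<close>: the products of the
  two pairs are equal.\<close>

lemma conjugate_generators_homologous:
  assumes "u \<in> carrier E" and "x \<in> X"
  shows "frag_of [p (e x)] - frag_of [p (e (\<psi> u x))] \<in> boundaries 1 G"
proof -
  let ?y = "\<psi> u x"
  have y: "?y \<in> X" using assms by simp
  have "(frag_of [p (e x)] + frag_of [p u] - frag_of [p (e x) \<otimes>\<^bsub>G\<^esub> p u]) -
      (frag_of [p u] + frag_of [p (e ?y)] - frag_of [p u \<otimes>\<^bsub>G\<^esub> p (e ?y)]) \<in> boundaries 1 G"
    using assms y by (intro boundaries_closed G.mult_mod_boundaries) auto
  then show ?thesis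
    by (simp add: p_e_commute[OF assms])
qed

lemma rack_orbits_eq: "rack_orbits X (\<triangleright>) = orb ` X"
  by (auto simp: rack_orbits_def orbits_def rack_orbit_def)

definition orbit_chain where
  "orbit_chain = frag_extend (\<lambda>\<omega>. frag_of [p (e (rep \<omega>))])"

text \<open>Both \<open>[g]\<close> and the orbit chain of \<open>g\<close> are additive in \<open>g\<close> modulo boundaries.  On a generator \<open>p (e x)\<close> they
  are homologous, since \<open>p (e x)\<close> is conjugate to \<open>p (e r)\<close> for the chosen element \<open>r\<close> of the orbit of \<open>x\<close>.\<close>

lemma splits_first_homology_Inn_bar: "splits_first_homology G (\<lambda>g. orbit_chain (fst g))"
  unfolding splits_first_homology_def
proof (intro conjI ballI homI)
  fix g assume "g \<in> carrier G"
  then obtain u where u: "u \<in> carrier E" "g = p u" by (auto simp: carrier_Inn_bar)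
  then have "Poly_Mapping.keys (fst g) \<subseteq> rack_orbits X (\<triangleright>)"
    using \<alpha>.hom_closed[of u] by simp
  moreover have "[p (e (rep \<omega>))] \<in> bar_basis 1 G" if "\<omega> \<in> rack_orbits X (\<triangleright>)" for \<omega>
    using that by (auto simp: rack_orbits_eq bar_basis_1)
  ultimately show "orbit_chain (fst g) \<in> carrier (bar_chain_group 1 G)"
    unfolding orbit_chain_def carrier_bar_chain_group
    by (intro order_trans[OF keys_frag_extend]) auto
  have "u \<in> carrier E \<and> frag_of [p u] - orbit_chain (\<alpha> u) \<in> boundaries 1 G"
    using u(1)[unfolded carrier_As]
  proof induction
    case one
    then show ?case
      using G.mult_mod_boundaries[of "\<one>\<^bsub>G\<^esub>" "\<one>\<^bsub>G\<^esub>"] p.hom_one \<alpha>.hom_one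
      by (simp add: orbit_chain_def)
  next
    case (incl h)
    then obtain x where x: "x \<in> X" "h = e x" by blast
    obtain f where f: "f \<in> carrier I" "f x = rep (orb x)" by (rule rep[OF x(1)])
    obtain v where "v \<in> carrier E" "f = \<psi> v" using f(1) psi_surj by blast
    then show ?case
      using conjugate_generators_homologous[of v x] x f by (simp add: orbit_chain_def)
  next
    case (inv h)
    then obtain x where x: "x \<in> X" "h = e x" by blast
    obtain f where f: "f \<in> carrier I" "f x = rep (orb x)" by (rule rep[OF x(1)])
    obtain v where v: "v \<in> carrier E" "f = \<psi> v" using f(1) psi_surj by blast
    have h: "h \<in> carrier E" using x by simp
    have A: "frag_of [p h] - orbit_chain (\<alpha> h) \<in> boundaries 1 G"
      using conjugate_generators_homologous[of v x] x f v by (simp add: orbit_chain_def)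
    have B: "frag_of [\<one>\<^bsub>G\<^esub>] \<in> boundaries 1 G"
      using G.mult_mod_boundaries[of "\<one>\<^bsub>G\<^esub>" "\<one>\<^bsub>G\<^esub>"] by simp
    have C: "frag_of [p h] + frag_of [p (inv\<^bsub>E\<^esub> h)] - frag_of [\<one>\<^bsub>G\<^esub>] \<in> boundaries 1 G"
      using G.mult_mod_boundaries[of "p h" "p (inv\<^bsub>E\<^esub> h)"] h by simp
    have "frag_of [p h] + frag_of [p (inv\<^bsub>E\<^esub> h)] - frag_of [\<one>\<^bsub>G\<^esub>] + frag_of [\<one>\<^bsub>G\<^esub>] -
        (frag_of [p h] - orbit_chain (\<alpha> h)) \<in> boundaries 1 G"
      by (rule boundaries_closed(2)[OF boundaries_closed(1)[OF C B] A])
    then show ?case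
      using h \<alpha>.hom_inv[OF h] \<alpha>.hom_closed[OF h] by (simp add: orbit_chain_def frag_extend_minus)
  next
    case (eng v w)
    have "frag_of [p v] + frag_of [p w] - frag_of [p v \<otimes>\<^bsub>G\<^esub> p w] \<in> boundaries 1 G"
      using eng by (intro G.mult_mod_boundaries) auto
    then have "(frag_of [p v] - orbit_chain (\<alpha> v)) + (frag_of [p w] - orbit_chain (\<alpha> w)) -
        (frag_of [p v] + frag_of [p w] - frag_of [p v \<otimes>\<^bsub>G\<^esub> p w]) \<in> boundaries 1 G"
      by (rule boundaries_closed(2)[OF boundaries_closed(1)[OF eng.IH(1)[THEN conjunct2] eng.IH(2)[THEN conjunct2]]])
    then show ?case
      using eng by (simp add: orbit_chain_def frag_extend_add \<alpha>.hom_mult p.hom_mult algebra_simps)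
  qed
  then show "frag_of [g] - orbit_chain (fst g) \<in> boundaries 1 G"
    using u by simp
qed (simp add: mult_Inn_bar mult_bar_chain_group orbit_chain_def frag_extend_add)

text \<open>The projection of \<open>E\<close> to its abelianization takes the same value on \<open>e x\<close> and \<open>e y\<close> for \<open>x\<close> and \<open>y\<close> in
  one orbit, because these are conjugate.  It therefore factors through \<open>\<alpha>\<close>, which kills the kernel of \<open>p\<close>.\<close>

lemma kernel_subset_derived: "kernel E G p \<subseteq> derived E (carrier E)"
proof
  fix a assume a: "a \<in> kernel E G p"
  let ?D = "derived E (carrier E)"
  interpret D: normal ?D E
    by (rule E.derived_is_normal[OF E.normal_self])
  interpret Q: comm_group "E Mod ?D" by (rule E.derived_quot_is_comm_group)
  let ?q = "\<lambda>u. ?D #>\<^bsub>E\<^esub> u"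
  interpret q: group_hom E "E Mod ?D" ?q
    using D.r_coset_hom_Mod by unfold_locales
  have "(\<lambda>\<omega>. ?q (e (rep \<omega>))) ` rack_orbits X (\<triangleright>) \<subseteq> carrier (E Mod ?D)"
    by (auto simp: rack_orbits_eq)
  then obtain t where t: "t \<in> hom (free_Abelian_group (rack_orbits X (\<triangleright>))) (E Mod ?D)"
    and t_orb: "\<And>\<omega>. \<omega> \<in> rack_orbits X (\<triangleright>) \<Longrightarrow> t (frag_of \<omega>) = ?q (e (rep \<omega>))"
    by (rule Q.free_Abelian_group_universal) blast
  have "?q (e x) = t (\<alpha> (e x))" if x: "x \<in> X" for x
  proof -
    obtain f where f: "f \<in> carrier I" "f x = rep (orb x)" by (rule rep[OF x])
    obtain v where v: "v \<in> carrier E" "f = \<psi> v" using f(1) psi_surj by blast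
    have r: "e (rep (orb x)) \<in> carrier E" using x by simp
    note closed = q.hom_closed[OF e_closed[OF x]] q.hom_closed[OF v(1)] q.hom_closed[OF r]
    have "?q (e x) \<otimes>\<^bsub>E Mod ?D\<^esub> ?q v = ?q v \<otimes>\<^bsub>E Mod ?D\<^esub> ?q (e (rep (orb x)))"
      using conjugate_generator[OF v(1) x] q.hom_mult[of "e x" v] q.hom_mult[of v "e (rep (orb x))"] v x f r
      by simp
    then have "?q v \<otimes>\<^bsub>E Mod ?D\<^esub> ?q (e x) = ?q v \<otimes>\<^bsub>E Mod ?D\<^esub> ?q (e (rep (orb x)))"
      by (rule HOL.trans[OF Q.m_comm[OF closed(2,1)]])
    then have "?q (e x) = ?q (e (rep (orb x)))"
      using closed(2,1,3) by (simp only: Q.Units_eq Q.Units_l_cancel)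
    then show ?thesis
      using x by (simp add: t_orb orb_in_orbits)
  qed
  then have "?q (e x) = (t \<circ> \<alpha>) (e x)" if "x \<in> X" for x
    unfolding o_def using that .
  then have "?q a = (t \<circ> \<alpha>) a"
    by (rule As_hom_eqI[OF Q.is_group q.homh hom_compose[OF alpha_hom t] _ kernel_alpha_psi(1)[OF a]])
  also have "\<dots> = ?D"
    using kernel_alpha_psi(2)[OF a] hom_one[OF t group_free_Abelian_group Q.is_group] by simp
  finally show "a \<in> ?D"
    using E.coset_join1[OF _ _ D.is_subgroup] kernel_alpha_psi(1)[OF a] D.subset by blast
qed

lemma s_bar_eq: "s_bar X (\<triangleright>) x = p (e x)"
  by (simp add: s_bar_def)

lemma stabilizer_Inn_bar:
  "stabilizer G snd x = p ` {u \<in> carrier E. \<psi> u x = x}"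
  by (auto simp: stabilizer_def carrier_Inn_bar)

lemma p_e_commute_stabilizer:
  assumes "h \<in> stabilizer G snd x" and "x \<in> X"
  shows "p (e x) \<otimes>\<^bsub>G\<^esub> h = h \<otimes>\<^bsub>G\<^esub> p (e x)"
  using assms p_e_commute by (auto simp: stabilizer_Inn_bar)

abbreviation N where "N \<equiv> pontryagin_sum X (\<triangleright>)"

text \<open>The generators of the sum of Pontryagin products, written with bar cycles.\<close>

definition pontryagin_classes where
  "pontryagin_classes =
    (\<Union>x\<in>X. (\<lambda>h. homology_class 2 G (frag_of [p (e x), h] - frag_of [h, p (e x)])) ` stabilizer G snd x)"

lemma stabilizer_closed: "h \<in> stabilizer G snd x \<Longrightarrow> h \<in> carrier G"
  by (simp add: stabilizer_def)

lemma pontryagin_sum_eq: "N = generate (homology 2 G) pontryagin_classes"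
proof -
  have "pontryagin_set G (s_bar X (\<triangleright>) x) (stabilizer G snd x) =
      (\<lambda>h. homology_class 2 G (frag_of [p (e x), h] - frag_of [h, p (e x)])) ` stabilizer G snd x"
    if "x \<in> X" for x
    unfolding pontryagin_set_def s_bar_eq Setcompr_eq_image
    using that p_e_commute_stabilizer
    by (intro image_cong HOL.refl G.pontryagin_eq) (auto simp: stabilizer_closed)
  then have "(\<Union>x\<in>X. pontryagin_set G (s_bar X (\<triangleright>) x) (stabilizer G snd x)) = pontryagin_classes"
    unfolding pontryagin_classes_def by (rule SUP_cong[OF HOL.refl])
  then show ?thesis by (simp add: pontryagin_sum_def)
qed

lemma pontryagin_classes_closed: "pontryagin_classes \<subseteq> carrier (homology 2 G)"
  using G.pontryagin_cycle[OF p.hom_closed[OF e_closed] stabilizer_closed p_e_commute_stabilizer]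
  by (auto simp: pontryagin_classes_def G.carrier_homology_2)

lemma subgroup_pontryagin_sum: "subgroup N (homology 2 G)"
proof -
  interpret H: comm_group "homology 2 G" by (rule G.comm_group_homology_2)
  show ?thesis
    unfolding pontryagin_sum_eq by (rule H.generate_is_subgroup[OF pontryagin_classes_closed])
qed

text \<open>For \<open>u \<in> E\<close> with \<open>\<psi> u x = x\<close> the elements \<open>e x\<close> and \<open>u\<close> commute, so the factor set is symmetric at their
  images, and its evaluation on \<open>[p (e x)|p u] - [p u|p (e x)]\<close> is trivial.\<close>

lemma pontryagin_sum_subset_kernel: "N \<subseteq> kernel (homology 2 G) K (eval_cocycle K factor_set)"
proof -
  interpret H: comm_group "homology 2 G" by (rule G.comm_group_homology_2)
  interpret \<phi>: group_hom "homology 2 G" K "eval_cocycle K factor_set"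
    using G.eval_cocycle_hom[OF K.comm_group_axioms two_cocycle_factor_set] by unfold_locales
  have "eval_cocycle K factor_set U = \<one>\<^bsub>K\<^esub>" if U: "U \<in> pontryagin_classes" for U
  proof -
    obtain x u where xu: "x \<in> X" "u \<in> carrier E" "\<psi> u x = x"
      and U_eq: "U = homology_class 2 G (frag_of [p (e x), p u] - frag_of [p u, p (e x)])"
      using U by (auto simp: pontryagin_classes_def stabilizer_Inn_bar)
    let ?a = "frag_of [p (e x), p u]" and ?b = "frag_of [p u, p (e x)]"
    have comm: "e x \<otimes>\<^bsub>E\<^esub> u = u \<otimes>\<^bsub>E\<^esub> e x"
      using conjugate_generator[OF xu(2,1)] xu(3) by simp
    have z: "?a - ?b \<in> carrier (cycle_group 2 G)"
      using xu p_e_commute[OF xu(2,1)] by (intro G.pontryagin_cycle) auto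
    have c: "?a - ?b \<in> carrier (bar_chain_group 2 G)" "?b \<in> carrier (bar_chain_group 2 G)"
      using z xu by (auto simp: carrier_cycle_group frag_of_2_chain)
    have ev: "eval_on_chain K factor_set \<in> hom (bar_chain_group 2 G) K"
      using eval_on_chain_hom[OF K.comm_group_axioms two_cocycleD(1)[OF two_cocycle_factor_set]] .
    have "eval_on_chain K factor_set (?a - ?b) \<otimes>\<^bsub>K\<^esub> factor_set (p u) (p (e x)) = factor_set (p (e x)) (p u)"
      using hom_mult[OF ev c] xu
      by (simp add: mult_bar_chain_group eval_on_chain_frag_of[OF K.comm_group_axioms])
    also have "\<dots> = factor_set (p u) (p (e x))"
      using xu comm by (intro factor_set_commute) auto
    finally have "eval_on_chain K factor_set (?a - ?b) = \<one>\<^bsub>K\<^esub>"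
      using hom_in_carrier[OF ev c(1)] xu by simp
    then show ?thesis
      unfolding U_eq by (simp add: G.eval_cocycle_class[OF K.comm_group_axioms two_cocycle_factor_set z])
  qed
  then have "pontryagin_classes \<subseteq> kernel (homology 2 G) K (eval_cocycle K factor_set)"
    using pontryagin_classes_closed by (auto simp: kernel_def[of "homology 2 G"])
  then show ?thesis
    unfolding pontryagin_sum_eq by (rule H.generate_subgroup_incl[OF _ \<phi>.subgroup_kernel])
qed

text \<open>The symmetry of \<open>u\<close> says that lifts of \<open>p (e x)\<close> commute with lifts of the stabilizer of \<open>x\<close>.  Fix the
  lift \<open>\<tau> (p (e r))\<close> for the chosen element \<open>r\<close> of each orbit, and for \<open>x = r \<cdot> k\<close> let \<open>f x\<close> be its
  conjugate by a lift of \<open>k\<close>.  Two choices of \<open>k\<close> differ by an element of the stabilizer of \<open>r\<close>, so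
  conjugation by a lift of \<open>g\<close> takes \<open>f x\<close> to \<open>f (x \<cdot> g)\<close>.  In particular \<open>f\<close> satisfies the relations of
  the associated group.\<close>

lemma As_lifts_to_extension:
  assumes M: "comm_group M" and u: "two_cocycle G M u"
    and comm: "\<And>x h. x \<in> X \<Longrightarrow> h \<in> stabilizer G snd x \<Longrightarrow> u (p (e x)) h = u h (p (e x))"
  obtains \<Phi> where "\<Phi> \<in> hom E (cocycle_extension G M u)"
    and "\<And>v. v \<in> carrier E \<Longrightarrow> snd (\<Phi> v) = p v"
proof -
  interpret M: comm_group M by fact
  let ?F = "cocycle_extension G M u"
  interpret F: group ?F by (rule group_cocycle_extension[OF G.is_group M u])

  define \<tau> where "\<tau> g = (\<one>\<^bsub>M\<^esub>, g)" for g :: "('a set \<Rightarrow>\<^sub>0 int) \<times> ('a \<Rightarrow> 'a)"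
  have \<tau>: "\<tau> g \<in> carrier ?F" "snd (\<tau> g) = g" if "g \<in> carrier G" for g
    using that by (simp_all add: \<tau>_def carrier_cocycle_extension)
  have snd_hom: "snd \<in> hom ?F G"
    by (rule homI) (auto simp: carrier_cocycle_extension mult_cocycle_extension)
  interpret snd: group_hom ?F G snd using snd_hom by unfold_locales
  have act: "snd (snd (a \<otimes>\<^bsub>?F\<^esub> b)) y = snd (snd b) (snd (snd a) y)"
    if "a \<in> carrier ?F" "b \<in> carrier ?F" "y \<in> X" for a b y
  proof -
    have "snd (snd a) \<in> carrier I" "snd (snd b) \<in> carrier I"
      using that by (auto simp: carrier_cocycle_extension carrier_Inn_bar)
    then show ?thesis using that by (simp add: snd.hom_mult mult_Inn_bar)
  qed
  have \<tau>_commute: "t \<otimes>\<^bsub>?F\<^esub> \<tau> (p (e y)) = \<tau> (p (e y)) \<otimes>\<^bsub>?F\<^esub> t"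
    if t: "t \<in> carrier ?F" and y: "y \<in> X" and fixes_y: "snd (snd t) y = y" for t y
  proof -
    obtain b h where bh: "t = (b, h)" "b \<in> carrier M" "h \<in> carrier G"
      using t by (auto simp: carrier_cocycle_extension)
    then have h: "h \<in> stabilizer G snd y" using fixes_y by (simp add: stabilizer_def)
    show ?thesis
      using bh y comm[OF y h] p_e_commute_stabilizer[OF h y]
      by (simp add: \<tau>_def mult_cocycle_extension two_cocycleD(1)[OF u] M.m_comm)
  qed
  have "\<exists>k. \<forall>x\<in>X. k x \<in> carrier E \<and> \<psi> (k x) (rep (orb x)) = x"
  proof (rule bchoice, rule ballI)
    fix x assume x: "x \<in> X"
    obtain f where f: "f \<in> carrier I" "f x = rep (orb x)" by (rule rep[OF x])
    obtain v where v: "v \<in> carrier E" "f = \<psi> v" using f(1) psi_surj by blast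
    have "\<psi> (inv\<^bsub>E\<^esub> v) (\<psi> v x) = x"
      using v x Inn_mult_apply[of "\<psi> v" "\<psi> (inv\<^bsub>E\<^esub> v)" x] by (simp del: Inn_mult_apply)
    then show "\<exists>k. k \<in> carrier E \<and> \<psi> k (rep (orb x)) = x"
      using v f by (intro exI[of _ "inv\<^bsub>E\<^esub> v"]) simp
  qed
  then obtain k where k: "\<And>x. x \<in> X \<Longrightarrow> k x \<in> carrier E"
    and kx: "\<And>x. x \<in> X \<Longrightarrow> \<psi> (k x) (rep (orb x)) = x"
    by blast
  define c where "c x = \<tau> (p (k x))" for x
  define r where "r x = \<tau> (p (e (rep (orb x))))" for x
  define f where "f x = inv\<^bsub>?F\<^esub> c x \<otimes>\<^bsub>?F\<^esub> r x \<otimes>\<^bsub>?F\<^esub> c x" for x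
  have c [simp]: "c x \<in> carrier ?F" "snd (c x) = p (k x)" and r [simp]: "r x \<in> carrier ?F"
    "snd (r x) = p (e (rep (orb x)))" if "x \<in> X" for x
    using that by (simp_all add: c_def r_def \<tau> k)
  have f [simp]: "f x \<in> carrier ?F" if "x \<in> X" for x
    using that by (simp add: f_def)
  have snd_f [simp]: "snd (f x) = p (e x)" if x: "x \<in> X" for x
  proof -
    have "snd (f x) = inv\<^bsub>G\<^esub> p (k x) \<otimes>\<^bsub>G\<^esub> (p (e (rep (orb x))) \<otimes>\<^bsub>G\<^esub> p (k x))"
      using x k[OF x] by (simp add: f_def snd.hom_mult snd.hom_inv G.m_assoc)
    also have "\<dots> = p (e x)"
      using x k[OF x] p_e_commute[OF k[OF x], of "rep (orb x)"]
      by (simp add: kx G.m_assoc[symmetric])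
    finally show ?thesis .
  qed
  have conj: "f x \<otimes>\<^bsub>?F\<^esub> t = t \<otimes>\<^bsub>?F\<^esub> f (snd (snd t) x)" if x: "x \<in> X" and t: "t \<in> carrier ?F" for x t
  proof -
    let ?y = "snd (snd t) x"
    have tI: "snd (snd t) \<in> carrier I"
      using t by (auto simp: carrier_cocycle_extension carrier_Inn_bar)
    have y: "?y \<in> X" and orb_y: "orb ?y = orb x"
      using tI x by (simp_all add: orb_invariant)
    have ry: "r ?y = r x" by (simp add: r_def orb_y)
    \<comment> \<open>\<open>w\<close> lies over an element that fixes \<open>r\<close>: it moves \<open>r\<close> to \<open>x\<close>, then to \<open>y\<close>, and back to \<open>r\<close>.\<close>
    define w where "w = c x \<otimes>\<^bsub>?F\<^esub> t \<otimes>\<^bsub>?F\<^esub> inv\<^bsub>?F\<^esub> c ?y"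
    have w: "w \<in> carrier ?F" using x y t by (simp add: w_def)
    have wc: "w \<otimes>\<^bsub>?F\<^esub> c ?y = c x \<otimes>\<^bsub>?F\<^esub> t"
      using x y t by (simp add: w_def F.m_assoc)
    have "snd (snd (w \<otimes>\<^bsub>?F\<^esub> c ?y)) (rep (orb x)) = ?y"
      unfolding wc using x t by (simp add: act kx del: snd.hom_mult)
    then have "\<psi> (k ?y) (snd (snd w) (rep (orb x))) = \<psi> (k ?y) (rep (orb x))"
      using x y w kx[OF y] by (simp add: act orb_y del: snd.hom_mult)
    moreover have "inj_on (\<psi> (k ?y)) X"
      using \<psi>.hom_closed[OF k[OF y]] carrier_Inn_subset by (auto simp: Bij_def bij_betw_def)
    moreover have "snd (snd w) \<in> carrier I"
      using w by (auto simp: carrier_cocycle_extension carrier_Inn_bar)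
    ultimately have "snd (snd w) (rep (orb x)) = rep (orb x)"
      using x by (auto dest: inj_onD)
    then have wr: "w \<otimes>\<^bsub>?F\<^esub> r x = r x \<otimes>\<^bsub>?F\<^esub> w"
      unfolding r_def using x w by (intro \<tau>_commute) auto
    have "f x \<otimes>\<^bsub>?F\<^esub> t = inv\<^bsub>?F\<^esub> c x \<otimes>\<^bsub>?F\<^esub> r x \<otimes>\<^bsub>?F\<^esub> (w \<otimes>\<^bsub>?F\<^esub> c ?y)"
      unfolding wc using x t by (simp add: f_def F.m_assoc)
    also have "\<dots> = inv\<^bsub>?F\<^esub> c x \<otimes>\<^bsub>?F\<^esub> (r x \<otimes>\<^bsub>?F\<^esub> w) \<otimes>\<^bsub>?F\<^esub> c ?y"
      using x y w by (simp add: F.m_assoc)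
    also have "\<dots> = inv\<^bsub>?F\<^esub> c x \<otimes>\<^bsub>?F\<^esub> (w \<otimes>\<^bsub>?F\<^esub> r x) \<otimes>\<^bsub>?F\<^esub> c ?y"
      by (simp only: wr)
    also have "\<dots> = t \<otimes>\<^bsub>?F\<^esub> f ?y"
      using x y t by (simp add: w_def f_def ry F.m_assoc[symmetric])
    finally show ?thesis .
  qed
  have rel: "f x \<otimes>\<^bsub>?F\<^esub> f y = f y \<otimes>\<^bsub>?F\<^esub> f (x \<triangleright> y)" if "x \<in> X" "y \<in> X" for x y
    using conj[of x "f y"] that by simp
  have \<Phi>: "pres_lift ?F f \<in> hom E ?F"
    by (rule As_lift(1)[OF F.is_group f rel])
  have \<Phi>_gen: "pres_lift ?F f (e x) = f x" if "x \<in> X" for x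
    by (rule As_lift(2)[OF F.is_group f rel that])
  show thesis
  proof
    show "pres_lift ?F f \<in> hom E ?F" by (rule \<Phi>)
    have "(snd \<circ> pres_lift ?F f) v = p v" if "v \<in> carrier E" for v
    proof (rule As_hom_eqI[OF G.is_group hom_compose[OF \<Phi> snd_hom] p_hom _ that])
      show "(snd \<circ> pres_lift ?F f) (e x) = p (e x)" if "x \<in> X" for x
        unfolding o_def \<Phi>_gen[OF that] by (rule snd_f[OF that])
    qed
    then show "snd (pres_lift ?F f v) = p v" if "v \<in> carrier E" for v
      using that by simp
  qed
qed

text \<open>Apply the preceding construction to the universal cocycle modulo the group \<open>B\<close> of cycles that
  represent elements of \<open>N\<close>.  Naturality gives \<open>\<nu>\<close> that sends the value of the evaluation map on a
  cycle \<open>z\<close> to the class of \<open>z\<close> modulo \<open>B\<close>.  If the former is trivial, then \<open>z \<in> B\<close>.\<close>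

lemma kernel_subset_pontryagin_sum: "kernel (homology 2 G) K (eval_cocycle K factor_set) \<subseteq> N"
proof
  fix U assume U: "U \<in> kernel (homology 2 G) K (eval_cocycle K factor_set)"
  interpret H: comm_group "homology 2 G" by (rule G.comm_group_homology_2)
  interpret Z: comm_group "cycle_group 2 G" by (rule comm_group_cycle_group)
  interpret C: comm_group "bar_chain_group 2 G" by (rule comm_group_bar_chain_group)
  interpret h: group_hom "cycle_group 2 G" "homology 2 G" "homology_class 2 G"
    using G.homology_class_hom by unfold_locales
  define B where "B = {z \<in> carrier (cycle_group 2 G). homology_class 2 G z \<in> N}"
  note N = subgroup.m_closed[OF subgroup_pontryagin_sum] subgroup.m_inv_closed[OF subgroup_pontryagin_sum]
    subgroup.one_closed[OF subgroup_pontryagin_sum]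
  have one: "homology_class 2 G z = \<one>\<^bsub>homology 2 G\<^esub>" if "z \<in> boundaries 2 G" for z
  proof -
    have "homology_class 2 G z = homology_class 2 G 0"
      using that by (intro homology_class_eqI) simp
    also have "\<dots> = \<one>\<^bsub>homology 2 G\<^esub>"
      using h.hom_one by (simp add: cycle_group_def bar_chain_group_def)
    finally show ?thesis .
  qed
  have bound: "boundaries 2 G \<subseteq> B"
    using G.boundaries_are_cycles N(3) by (auto simp: B_def one)
  have B: "subgroup B (bar_chain_group 2 G)"
  proof (rule C.subgroupI)
    show "B \<subseteq> carrier (bar_chain_group 2 G)"
      by (auto simp: B_def carrier_cycle_group)
    show "B \<noteq> {}" using bound zero_in_boundaries by blast
  next
    fix z assume z: "z \<in> B"
    then have "homology_class 2 G (inv\<^bsub>cycle_group 2 G\<^esub> z) \<in> N"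
      using N(2) by (simp add: B_def)
    moreover have "inv\<^bsub>cycle_group 2 G\<^esub> z = inv\<^bsub>bar_chain_group 2 G\<^esub> z"
      using z by (simp add: B_def inv_cycle_group inv_bar_chain_group carrier_cycle_group[of z])
    ultimately show "inv\<^bsub>bar_chain_group 2 G\<^esub> z \<in> B"
      using z Z.inv_closed[of z] by (simp add: B_def)
  next
    fix y z assume yz: "y \<in> B" "z \<in> B"
    then have "homology_class 2 G (y \<otimes>\<^bsub>cycle_group 2 G\<^esub> z) \<in> N"
      using N(1) by (simp add: B_def)
    then show "y \<otimes>\<^bsub>bar_chain_group 2 G\<^esub> z \<in> B"
      using yz Z.m_closed[of y z] by (simp add: B_def mult_cycle_group mult_bar_chain_group)
  qed
  interpret B: normal B "bar_chain_group 2 G" using B by (simp add: C.normal_iff_subgroup)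
  define M where "M = bar_chain_group 2 G Mod B"
  define u where "u g h = B #>\<^bsub>bar_chain_group 2 G\<^esub> frag_of [g, h]" for g h
  have M: "comm_group M" and u: "two_cocycle G M u"
    and eval_u: "\<And>z. z \<in> carrier (bar_chain_group 2 G) \<Longrightarrow> eval_on_chain M u z = B #>\<^bsub>bar_chain_group 2 G\<^esub> z"
    using G.universal_cocycle[OF B bound] unfolding M_def u_def[abs_def] by blast+
  have comm: "u (p (e x)) h = u h (p (e x))" if x: "x \<in> X" and h: "h \<in> stabilizer G snd x" for x h
  proof -
    let ?a = "frag_of [p (e x), h]" and ?b = "frag_of [h, p (e x)]"
    have ab: "?a \<in> carrier (bar_chain_group 2 G)" "?b \<in> carrier (bar_chain_group 2 G)"
      using x h by (auto simp: frag_of_2_chain stabilizer_def)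
    have "homology_class 2 G (?a - ?b) \<in> N"
      unfolding pontryagin_sum_eq using x h
      by (intro generate.incl) (auto simp: pontryagin_classes_def)
    then have "?a - ?b \<in> B"
      using x h p_e_commute_stabilizer[OF h x]
      by (auto simp: B_def stabilizer_def intro!: G.pontryagin_cycle)
    then have "?a \<in> B #>\<^bsub>bar_chain_group 2 G\<^esub> ?b"
      using ab B.rcos_module[OF C.is_group ab(2,1)] by (simp add: inv_bar_chain_group mult_bar_chain_group)
    then show ?thesis
      unfolding u_def using ab(2) B by (intro C.repr_independence[symmetric])
  qed
  obtain \<Phi> where \<Phi>: "\<Phi> \<in> hom E (cocycle_extension G M u)"
    and over: "\<And>v. v \<in> carrier E \<Longrightarrow> snd (\<Phi> v) = p v"
    using As_lifts_to_extension[OF M u comm] by blast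
  obtain \<nu> where \<nu>: "\<nu> \<in> hom K M"
    and \<nu>_eval: "\<And>z. z \<in> carrier (cycle_group 2 G) \<Longrightarrow>
      \<nu> (eval_on_chain K factor_set z) = eval_on_chain M u z"
    using eval_cocycle_natural[OF M u \<Phi> over] by blast
  obtain z where z: "z \<in> carrier (cycle_group 2 G)" and Uz: "U = homology_class 2 G z"
    using U by (auto simp: kernel_def[of "homology 2 G"] G.carrier_homology_2)
  have "eval_on_chain K factor_set z = \<one>\<^bsub>K\<^esub>"
    using U by (simp add: kernel_def[of "homology 2 G"] Uz
        G.eval_cocycle_class[OF K.comm_group_axioms two_cocycle_factor_set z])
  then have "B #>\<^bsub>bar_chain_group 2 G\<^esub> z = B"
    using \<nu>_eval[OF z] hom_one[OF \<nu> K.is_group comm_group.axioms(2)[OF M]] z eval_u[of z]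
    by (simp add: M_def carrier_cycle_group)
  then have "z \<in> B"
    using C.coset_join1[OF _ _ B] z B.subset by (auto simp: carrier_cycle_group)
  then show "U \<in> N" by (simp add: B_def Uz)
qed

end

theorem theorem3p1:
  fixes X :: "'a set" and rop :: "'a \<Rightarrow> 'a \<Rightarrow> 'a"
  assumes "rack X rop"
  shows "central_extension (As_kernel X rop) (As X rop) (Inn_bar X rop)
           (\<lambda>a. a) (alpha_psi X rop) \<and>
    (\<exists>\<theta> \<in> iso (homology 2 (Inn_bar X rop) Mod pontryagin_sum X rop) (As_kernel X rop).
      \<exists>\<phi> \<in> hom (homology 2 (Inn_bar X rop)) (As_kernel X rop).
        (\<forall>U \<in> carrier (homology 2 (Inn_bar X rop)).
           \<phi> U = \<theta> (pontryagin_sum X rop #>\<^bsub>homology 2 (Inn_bar X rop)\<^esub> U)) \<and>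
        (\<exists>c. represents (Inn_bar X rop) (As_kernel X rop) \<phi> c) \<and>
        (\<forall>c. represents (Inn_bar X rop) (As_kernel X rop) \<phi> c \<longrightarrow>
           equivalent_extensions (As_kernel X rop)
             (As X rop) (\<lambda>a. a) (alpha_psi X rop)
             (cocycle_extension (Inn_bar X rop) (As_kernel X rop) c)
             (cocycle_incl (Inn_bar X rop) (As_kernel X rop) c) snd))"
proof -
  interpret rack X rop by fact
  show ?thesis
    unfolding As_kernel_eq
    using central_extension stem_extension_homology[OF splits_first_homology_Inn_bar kernel_subset_derived
        equalityI[OF pontryagin_sum_subset_kernel kernel_subset_pontryagin_sum]]
    by (rule conjI)
qed

end
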